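(* Let $G\le\mathrm{Aut}(X^* )$ be a self-similar, level-transitive, regular branch group with maximal branching subgroup $K$. Suppose that $\mathrm{St}_G(2)K\ge\mathrm{St}_G(1)$. (i) The rigid kernel of $G$ is trivial if and only if $\mathrm{St}_G(2)=\mathrm{Triv}_G(2)$. (ii) Suppose moreover that $G/K$ is in a class of groups that is closed under subgroups, quotients and direct products, in which all short exact sequences that are in the class split as direct products (for example, elementary abelian groups). Then the rigid kernel of $G$ is (isomorphic to) $$\Gamma=\frac{\mathrm{St}_G(2)}{\mathrm{Triv}_G(2)}\times\prod_{X^*\setminus\{\epsilon\}}\frac{\mathrm{St}_G(2)\cap K}{\mathrm{Triv}_G(2)}$$ and it is infinite if and only if $\dfrac{\mathrm{St}_G(2)\cap K}{\mathrm{Triv}_G(2)}$ is non-trivial.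
   Context: $X$ is a finite alphabet and $X^*$ is the set of finite words over $X$ (with empty word $\epsilon$), viewed as a regular rooted tree whose level $n$ is $X^n$. $\mathrm{Aut}(X^* )$ is its automorphism group. Each $g\in\mathrm{Aut}(X^* )$ is identified with its portrait $(g(u))_{u\in X^*}\in \mathrm{Sym}(X)^{X^*}$, where $g[x_1\cdots x_n]=y_1\cdots y_n$ with $y_i=g(x_1\cdots x_{i-1})(x_i)$; multiplication is $(fg)(u)=f(g[u])g(u)$. For $v\in X^*$ the section (shift) $g_v$ is given by $g_v(u)=g(vu)$. A group $G\le \mathrm{Aut}(X^* )$ is self-similar if $g_v\in G$ for all $g\in G$, $v\in X^*$. It is level-transitive if it acts transitively on each $X^n$. $\mathrm{St}(n)$ is the pointwise stabiliser of $X^n$ and $\mathrm{St}_G(n)=G\cap\mathrm{St}(n)$. For $g\in\mathrm{Aut}(X^* )$, $v\in X^*$, $\delta_v(g)$ is the automorphism that acts as $g$ on the subtree rooted at $v$ and fixes the rest of $X^*$; for $H\le \mathrm{Aut}(X^* )$, $X^n\ast H=\prod_{v\in X^n}\delta_v(H)$. A self-similar group $G$ branches over $H\le G$ if $X\ast H\le H$; it is regular branch if it branches over some finite-index normal subgroup. $\mathrm{Rst}_G(v)$ is the subgroup of elements of $G$ fixing all vertices outside the subtree rooted at $v$, and $\mathrm{Rst}_G(n)=\prod_{v\in X^n}\mathrm{Rst}_G(v)$. The unique maximal branching subgroup of $G$ is $K=\bigcap_{u\in X^*}(\mathrm{Rst}_G(u))_u$, where $(\mathrm{Rst}_G(u))_u=\{g_u: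 g\in \mathrm{Rst}_G(u)\}$. For $n\ge1$, $\mathrm{Triv}_G(n)=\mathrm{St}_G(n)\cap (X^{n-1}\ast K)$; in particular $\mathrm{Triv}_G(2)=\mathrm{St}_G(2)\cap (X\ast K)\le \mathrm{St}_G(2)\cap K$. The rigid kernel of $G$ is the kernel of the natural map $\varprojlim_n G/\mathrm{Rst}_G(n)\to\varprojlim_n G/\mathrm{St}_G(n)$; for level-transitive $G$ it equals $\ker(\varprojlim_n G/\mathrm{Triv}_G(n)\to\varprojlim_n G/\mathrm{St}_G(n))=\varprojlim_n \mathrm{St}_G(n)/\mathrm{Triv}_G(n)$. *)

theory Defs
  imports "HOL-Algebra.Algebra" "HOL-Library.Sublist"
begin

section \<open>Automorphisms of the rooted tree of words, as portraits\<close>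

text \<open>The alphabet is the finite type \<open>'x\<close>; an automorphism is identified with its portrait.\<close>

type_synonym 'x portrait = "'x list \<Rightarrow> 'x \<Rightarrow> 'x"

definition level :: "nat \<Rightarrow> 'x list set" where
  "level n = {u. length u = n}"

definition act :: "'x portrait \<Rightarrow> 'x list \<Rightarrow> 'x list" where
  "act g u = map (\<lambda>i. g (take i u) (u ! i)) [0..<length u]"

definition Aut_tree :: "'x portrait monoid" where
  "Aut_tree = \<lparr>carrier = {g. \<forall>u. bij (g u)},
               monoid.mult = (\<lambda>f g u. f (act g u) \<circ> g u),
               one = (\<lambda>u. id)\<rparr>"

abbreviation as_group :: "'x portrait set \<Rightarrow> 'x portrait monoid" where
  "as_group H \<equiv> Aut_tree\<lparr>carrier := H\<rparr>"

definition sect :: "'x portrait \<Rightarrow> 'x list \<Rightarrow> 'x portrait" where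
  "sect g v = (\<lambda>u. g (v @ u))"

definition self_similar :: "'x portrait set \<Rightarrow> bool" where
  "self_similar G \<longleftrightarrow> (\<forall>g\<in>G. \<forall>v. sect g v \<in> G)"

definition level_transitive :: "'x portrait set \<Rightarrow> bool" where
  "level_transitive G \<longleftrightarrow> (\<forall>n. \<forall>u\<in>level n. \<forall>v\<in>level n. \<exists>g\<in>G. act g u = v)"

definition St :: "'x portrait set \<Rightarrow> nat \<Rightarrow> 'x portrait set" where
  "St G n = {g \<in> G. \<forall>u\<in>level n. act g u = u}"

definition delta :: "'x list \<Rightarrow> 'x portrait \<Rightarrow> 'x portrait" where
  "delta v g = (\<lambda>u. if prefix v u then g (drop (length v) u) else id)"

text \<open>Internal product of a finite family of subsets: all products of one element from each
  member. It is used only for families whose members commute elementwise, so that the order of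
  the factors is irrelevant.\<close>

definition internal_prod :: "('a, 'm) monoid_scheme \<Rightarrow> 'i set \<Rightarrow> ('i \<Rightarrow> 'a set) \<Rightarrow> 'a set" where
  "internal_prod M I H =
     {foldr (\<lambda>i y. h i \<otimes>\<^bsub>M\<^esub> y) js \<one>\<^bsub>M\<^esub> | h js.
        distinct js \<and> set js = I \<and> (\<forall>i\<in>I. h i \<in> H i)}"

definition level_prod :: "nat \<Rightarrow> 'x::finite portrait set \<Rightarrow> 'x portrait set" (infixr \<open>\<star>\<close> 75) where
  "n \<star> H = internal_prod Aut_tree (level n) (\<lambda>v. delta v ` H)"

definition regular_branch :: "'x::finite portrait set \<Rightarrow> bool" where
  "regular_branch G \<longleftrightarrow>
     (\<exists>H. H \<lhd> as_group G \<and> finite (rcosets\<^bsub>as_group G\<^esub> H) \<and> 1 \<star> H \<subseteq> H)"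

definition Rst :: "'x portrait set \<Rightarrow> 'x list \<Rightarrow> 'x portrait set" where
  "Rst G v = {g \<in> G. \<forall>u. \<not> prefix v u \<longrightarrow> act g u = u}"

definition Rst_level :: "'x::finite portrait set \<Rightarrow> nat \<Rightarrow> 'x portrait set" where
  "Rst_level G n = internal_prod Aut_tree (level n) (Rst G)"

definition max_branching :: "'x portrait set \<Rightarrow> 'x portrait set" where
  "max_branching G = (\<Inter>u. (\<lambda>g. sect g u) ` Rst G u)"

text \<open>Only meaningful for \<open>n \<ge> 1\<close>.\<close>

definition Triv :: "'x::finite portrait set \<Rightarrow> nat \<Rightarrow> 'x portrait set" where
  "Triv G n = St G n \<inter> ((n - 1) \<star> max_branching G)"


section \<open>The rigid kernel\<close>

definition inverse_limit ::
    "(nat \<Rightarrow> ('b, 'm) monoid_scheme) \<Rightarrow> (nat \<Rightarrow> 'b \<Rightarrow> 'b) \<Rightarrow> (nat \<Rightarrow> 'b) monoid" where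
  "inverse_limit A p =
     \<lparr>carrier = {s. \<forall>n. s n \<in> carrier (A n) \<and> p n (s (Suc n)) = s n},
      monoid.mult = (\<lambda>s t n. s n \<otimes>\<^bsub>A n\<^esub> t n),
      one = (\<lambda>n. \<one>\<^bsub>A n\<^esub>)\<rparr>"

text \<open>For \<open>M \<le> N\<close>, the natural projection from cosets of \<open>M\<close> to cosets of \<open>N\<close> sends \<open>C\<close> to
  the coset \<open>N <#> C\<close>, the unique coset of \<open>N\<close> containing \<open>C\<close>.\<close>

definition quotient_limit ::
    "('a, 'm) monoid_scheme \<Rightarrow> (nat \<Rightarrow> 'a set) \<Rightarrow> (nat \<Rightarrow> 'a set) monoid" where
  "quotient_limit G N = inverse_limit (\<lambda>n. G Mod N n) (\<lambda>n C. N n <#>\<^bsub>G\<^esub> C)"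

definition rigid_kernel :: "'x::finite portrait set \<Rightarrow> (nat \<Rightarrow> 'x portrait set) monoid" where
  "rigid_kernel G =
     (let L = quotient_limit (as_group G) (Rst_level G);
          M = quotient_limit (as_group G) (St G)
      in L\<lparr>carrier := kernel L M (\<lambda>s n. St G n <#>\<^bsub>as_group G\<^esub> s n)\<rparr>)"


section \<open>Classes of groups\<close>

text \<open>A class of groups is an isomorphism-closed predicate on the groups whose elements have an
  arbitrary type \<open>'c\<close>; a group over another type belongs to it if it has an isomorphic copy
  in it.\<close>

definition in_class :: "('c monoid \<Rightarrow> bool) \<Rightarrow> 'a monoid \<Rightarrow> bool" where
  "in_class \<C> A \<longleftrightarrow> (\<exists>B. \<C> B \<and> B \<cong> A)"

definition group_class :: "('c monoid \<Rightarrow> bool) \<Rightarrow> bool" where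
  "group_class \<C> \<longleftrightarrow>
     (\<forall>A. \<C> A \<longrightarrow> group A) \<and> (\<forall>A B. \<C> A \<and> group B \<and> A \<cong> B \<longrightarrow> \<C> B)"

definition closed_subgroups :: "('c monoid \<Rightarrow> bool) \<Rightarrow> bool" where
  "closed_subgroups \<C> \<longleftrightarrow> (\<forall>A H. \<C> A \<and> subgroup H A \<longrightarrow> \<C> (A\<lparr>carrier := H\<rparr>))"

definition closed_quotients :: "('c monoid \<Rightarrow> bool) \<Rightarrow> bool" where
  "closed_quotients \<C> \<longleftrightarrow> (\<forall>A N. \<C> A \<and> N \<lhd> A \<longrightarrow> in_class \<C> (A Mod N))"

definition closed_products :: "('c monoid \<Rightarrow> bool) \<Rightarrow> bool" where
  "closed_products \<C> \<longleftrightarrow> (\<forall>A B. \<C> A \<and> \<C> B \<longrightarrow> in_class \<C> (A \<times>\<times> B))"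

text \<open>The sequence is \<open>N \<rightarrow> A \<rightarrow> Q\<close> with maps \<open>f\<close> and \<open>g\<close> (the library lists it from the
  right); splitting is compatible with the inclusion of \<open>N\<close> and the projection onto \<open>Q\<close>.\<close>

definition sequences_split :: "('c monoid \<Rightarrow> bool) \<Rightarrow> bool" where
  "sequences_split \<C> \<longleftrightarrow>
     (\<forall>N A Q f g. \<C> N \<and> \<C> A \<and> \<C> Q \<and> short_exact_sequence Q A N g f \<longrightarrow>
        (\<exists>\<theta>\<in>iso A (N \<times>\<times> Q).
           (\<forall>x\<in>carrier N. \<theta> (f x) = (x, \<one>\<^bsub>Q\<^esub>)) \<and> (\<forall>a\<in>carrier A. snd (\<theta> a) = g a)))"


section \<open>Basic facts\<close>

lemma length_act [simp]: "length (act g u) = length u"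
  by (simp add: act_def)

lemma act_snoc: "act g (u @ [x]) = act g u @ [g u x]"
  by (auto simp: act_def nth_append)

lemma act_Nil [simp]: "act g [] = []"
  by (simp add: act_def)

lemma act_append: "act g (v @ u) = act g v @ act (sect g v) u"
proof (induction u rule: rev_induct)
  case (snoc x u)
  have "act g ((v @ u) @ [x]) = act g v @ act (sect g v) (u @ [x])"
    unfolding act_snoc using snoc by (simp add: sect_def)
  then show ?case by simp
qed simp

lemma act_id: "act (\<lambda>u. id) u = u"
  by (induction u rule: rev_induct) (auto simp: act_snoc)

lemma act_mult: "act (f \<otimes>\<^bsub>Aut_tree\<^esub> g) u = act f (act g u)"
  by (induction u rule: rev_induct) (auto simp: act_snoc Aut_tree_def)

lemma act_eq_imp_eq:
  assumes "act f = act g" shows "f = g"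
proof (intro ext)
  fix u x
  have "act f (u @ [x]) = act g (u @ [x])" using assms by simp
  then show "f u x = g u x" by (simp add: act_snoc)
qed

lemma bij_act:
  assumes "g \<in> carrier Aut_tree" shows "bij (act g)"
proof (rule bijI)
  have b: "bij (g u)" for u using assms by (simp add: Aut_tree_def)
  have "act g u = act g v \<Longrightarrow> u = v" for u v
  proof (induction u arbitrary: v rule: rev_induct)
    case Nil
    then have "length v = 0" by (metis length_act list.size(3))
    then show ?case by simp
  next
    case (snoc x u)
    then obtain w y where v: "v = w @ [y]"
      by (metis length_act length_append_singleton length_0_conv nat.distinct(1) rev_exhaust)
    with snoc have "u = w" "g u x = g w y" by (auto simp: act_snoc)
    with v b[of u] show ?case by (auto simp: bij_def inj_def)
  qed
  then show "inj (act g)" by (auto intro: injI)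
  have "\<exists>u. act g u = v" for v
  proof (induction v rule: rev_induct)
    case Nil show ?case by (rule exI[of _ "[]"]) simp
  next
    case (snoc y v)
    then obtain u where "act g u = v" by blast
    moreover obtain x where "g u x = y" using b[of u] by (metis bij_pointE)
    ultimately show ?case by (intro exI[of _ "u @ [x]"]) (simp add: act_snoc)
  qed
  then show "surj (act g)" by (metis surjI)
qed

lemma group_Aut_tree: "group (Aut_tree :: 'x portrait monoid)"
proof (rule groupI)
  fix x y z :: "'x portrait"
  assume x: "x \<in> carrier Aut_tree" and y: "y \<in> carrier Aut_tree"
  then show "x \<otimes>\<^bsub>Aut_tree\<^esub> y \<in> carrier Aut_tree"
    by (auto simp: Aut_tree_def intro: bij_comp)
  show "x \<otimes>\<^bsub>Aut_tree\<^esub> y \<otimes>\<^bsub>Aut_tree\<^esub> z = x \<otimes>\<^bsub>Aut_tree\<^esub> (y \<otimes>\<^bsub>Aut_tree\<^esub> z)"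
    by (rule act_eq_imp_eq) (auto simp: act_mult)
  show "\<one>\<^bsub>Aut_tree\<^esub> \<otimes>\<^bsub>Aut_tree\<^esub> x = x"
    by (auto simp: Aut_tree_def)
  let ?h = "\<lambda>w. inv_into UNIV (x (inv_into UNIV (act x) w))"
  have b: "bij (x u)" for u using x by (simp add: Aut_tree_def)
  have "?h \<in> carrier Aut_tree"
    using b by (auto simp: Aut_tree_def bij_imp_bij_inv)
  moreover have "?h \<otimes>\<^bsub>Aut_tree\<^esub> x = \<one>\<^bsub>Aut_tree\<^esub>"
    using b bij_is_inj[OF bij_act[OF x]] by (auto simp: Aut_tree_def inv_f_f bij_is_inj intro!: ext)
  ultimately show "\<exists>y\<in>carrier Aut_tree. y \<otimes>\<^bsub>Aut_tree\<^esub> x = \<one>\<^bsub>Aut_tree\<^esub>" by blast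
next
  show "\<one>\<^bsub>Aut_tree\<^esub> \<in> carrier (Aut_tree :: 'x portrait monoid)" by (simp add: Aut_tree_def)
qed

lemma act_delta: "act (delta v g) (v @ u) = v @ act g u"
proof -
  have "act (delta v g) w = w" if "length w \<le> length v" for w
    using that
  proof (induction w rule: rev_induct)
    case (snoc x w)
    then show ?case by (auto simp: act_snoc delta_def dest: prefix_length_le)
  qed simp
  moreover have "sect (delta v g) v = g" by (auto simp: sect_def delta_def)
  ultimately show ?thesis by (simp add: act_append)
qed

end

theory Submission
  imports Defs
begin

text \<open>
  Write \<open>A\<^sub>v\<close> for the group of all \<open>k\<close> with \<open>\<delta>\<^sub>v(k) \<in> G\<close> (\<open>rigid_sect v\<close>), so that \<open>K = \<Inter>\<^sub>v A\<^sub>v\<close>, and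
  write \<open>S\<^sub>n\<close>, \<open>R\<^sub>n\<close> and \<open>T\<^sub>n\<close> for the \<open>n\<close>-th stabiliser, rigid stabiliser and \<open>Triv\<close> of \<open>G\<close>. All
  subgroups that occur are described by what their elements do at one level: \<open>R\<^sub>n\<close> consists of
  the automorphisms that fix level \<open>n\<close> and have sections in \<open>A\<^sub>v\<close> at its vertices \<open>v\<close>, and
  \<open>n \<star> K\<close> of those with sections in \<open>K\<close> instead. Hence \<open>n \<star> K \<subseteq> R\<^sub>n\<close>. Conversely
  \<open>R\<^sub>n \<subseteq> m \<star> K\<close> once \<open>n\<close> is large compared with \<open>m\<close> (\<open>Rst_level_subset_level_prod_K\<close>): the groups
  \<open>A\<^sub>v\<close> lie between a normal subgroup of finite index and \<open>G\<close>, they are conjugate within a level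
  and shrink when a letter is put in front of \<open>v\<close>, so from some length \<open>N\<close> on the group \<open>A\<^sub>v\<close> only
  depends on the last letters of \<open>v\<close>, and then the sections at level \<open>m\<close> of elements of
  \<open>R\<^sub>n\<close> lie in \<open>A\<^sub>t\<close> for every \<open>t\<close>. The filtrations \<open>R\<^sub>n\<close> and \<open>T\<^sub>n\<close> are therefore cofinal.

  Applied to the sections at level \<open>n\<close>, the hypothesis \<open>S\<^sub>1 \<subseteq> S\<^sub>2 K\<close> gives
  \<open>S\<^sub>n\<^sub>+\<^sub>1 \<subseteq> S\<^sub>n\<^sub>+\<^sub>2 (n \<star> K)\<close> (\<open>St_lift\<close>). So every \<open>g\<^sub>0 \<in> S\<^sub>2\<close> starts a sequence with
  \<open>g\<^sub>l \<in> S\<^sub>l\<^sub>+\<^sub>2\<close> and \<open>g\<^sub>l\<^sub>+\<^sub>1 \<in> g\<^sub>l ((l + 1) \<star> K)\<close>, and the cosets \<open>R\<^sub>n g\<^sub>n\<close> form an element of the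
  rigid kernel. If that element is trivial, then \<open>g\<^sub>l\<close> lies in \<open>1 \<star> K\<close> for large \<open>l\<close> by cofinality,
  hence so does \<open>g\<^sub>0\<close>; this is one half of the triviality criterion. For the other half,
  \<open>S\<^sub>2 = T\<^sub>2\<close> makes all sections of \<open>S\<^sub>n\<^sub>+\<^sub>2\<close> at level \<open>n\<close> lie in \<open>1 \<star> K\<close>, so \<open>S\<^sub>n\<^sub>+\<^sub>2 \<subseteq> R\<^sub>n\<close>.

  For the structure of the rigid kernel, observe that \<open>K\<close> is normal in \<open>G\<close>, because its cosets form
  a group. A single splitting suffices: \<open>S\<^sub>2/T\<^sub>2\<close> embeds into a finite power of \<open>G/K\<close> by
  taking sections at the first level, so it belongs to the class, and there is a homomorphic
  retraction \<open>\<rho>\<close> of \<open>S\<^sub>2/T\<^sub>2\<close> onto \<open>(S\<^sub>2 \<inter> K)/T\<^sub>2\<close>. An element \<open>s\<close> of the rigid kernel has at each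
  vertex \<open>v\<close> a coordinate in \<open>S\<^sub>2/T\<^sub>2\<close>: the class of the section at \<open>v\<close> of any
  representative of \<open>s\<close> at a deep level. The isomorphism sends \<open>s\<close> to its coordinate at the root
  together with the values of \<open>\<rho>\<close> on all other coordinates
  (\<open>rigid_kernel_iso_if_retraction\<close>). It is injective because triviality of the coordinates at
  level \<open>l\<close> forces those at level \<open>l + 1\<close> into \<open>(S\<^sub>2 \<inter> K)/T\<^sub>2\<close>, where \<open>\<rho>\<close> is the identity. It is
  surjective because the sequence \<open>g\<^sub>l\<close> can be corrected at each vertex of level \<open>l + 1\<close> by an
  arbitrary element of \<open>S\<^sub>2 \<inter> K\<close> (\<open>coherent_exists\<close>). Finally \<open>S\<^sub>2/T\<^sub>2\<close> is finite, so the rigid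
  kernel is infinite exactly when the factor that is repeated infinitely often is non-trivial.
\<close>

section \<open>Sections of tree automorphisms\<close>

interpretation Aut: group Aut_tree by (rule group_Aut_tree)

abbreviation aut_mult :: "'x portrait \<Rightarrow> 'x portrait \<Rightarrow> 'x portrait" (infixl \<open>\<odot>\<close> 70)
  where "f \<odot> g \<equiv> f \<otimes>\<^bsub>Aut_tree\<^esub> g"

abbreviation aut_inv :: "'x portrait \<Rightarrow> 'x portrait"
  where "aut_inv g \<equiv> inv\<^bsub>Aut_tree\<^esub> g"

lemma act_inj: "g \<in> carrier Aut_tree \<Longrightarrow> act g u = act g v \<Longrightarrow> u = v"
  using bij_act[of g] by (auto simp: bij_def inj_def)

lemma act_one [simp]: "act \<one>\<^bsub>Aut_tree\<^esub> u = u"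
  by (simp add: Aut_tree_def act_id)

lemma act_inv_act [simp]: "g \<in> carrier Aut_tree \<Longrightarrow> act (aut_inv g) (act g u) = u"
  by (simp flip: act_mult)

lemma act_act_inv [simp]: "g \<in> carrier Aut_tree \<Longrightarrow> act g (act (aut_inv g) u) = u"
  by (simp flip: act_mult)

lemma act_in_level [simp]: "act g u \<in> level n \<longleftrightarrow> u \<in> level n"
  by (simp add: level_def)

lemma act_take: "act g (take n u) = take n (act g u)"
proof -
  have "act g u = act g (take n u) @ act (sect g (take n u)) (drop n u)"
    using act_append[of g "take n u" "drop n u"] by simp
  then show ?thesis by (cases "n \<le> length u") auto
qed

lemma prefix_act_iff:
  assumes "g \<in> carrier Aut_tree"
  shows "prefix (act g v) (act g u) \<longleftrightarrow> prefix v u"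
proof
  assume "prefix (act g v) (act g u)"
  then have "act g v = take (length v) (act g u)" by (auto simp: prefix_def)
  then have "v = take (length v) u" using act_inj[OF assms] by (simp flip: act_take)
  then show "prefix v u" by (metis take_is_prefix)
qed (auto simp: prefix_def act_append)

lemma sect_mult: "sect (f \<odot> g) v = sect f (act g v) \<odot> sect g v"
  by (simp add: sect_def Aut_tree_def act_append fun_eq_iff)

lemma sect_one [simp]: "sect \<one>\<^bsub>Aut_tree\<^esub> v = \<one>\<^bsub>Aut_tree\<^esub>"
  by (simp add: sect_def Aut_tree_def fun_eq_iff)

lemma sect_sect [simp]: "sect (sect g v) w = sect g (v @ w)"
  by (simp add: sect_def)

lemma sect_Nil [simp]: "sect g [] = g"
  by (simp add: sect_def)

lemma sect_closed [simp]: "g \<in> carrier Aut_tree \<Longrightarrow> sect g v \<in> carrier Aut_tree"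
  by (simp add: sect_def Aut_tree_def)

lemma sect_inv:
  assumes g: "g \<in> carrier Aut_tree"
  shows "sect (aut_inv g) v = aut_inv (sect g (act (aut_inv g) v))"
proof -
  have "sect (aut_inv g) (act g (act (aut_inv g) v)) \<odot> sect g (act (aut_inv g) v) = \<one>\<^bsub>Aut_tree\<^esub>"
    using g by (metis sect_mult sect_one Aut.l_inv)
  then show ?thesis using g by (metis Aut.inv_equality Aut.inv_closed act_act_inv sect_closed)
qed

lemma delta_closed [simp]: "g \<in> carrier Aut_tree \<Longrightarrow> delta v g \<in> carrier Aut_tree"
  by (simp add: delta_def Aut_tree_def)

lemma delta_Nil [simp]: "delta [] g = g"
  by (simp add: delta_def)

lemma sect_delta_append: "sect (delta (v @ w) g) v = delta w g"
  by (auto simp: sect_def delta_def fun_eq_iff)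

lemma sect_delta_same [simp]: "sect (delta v g) v = g"
  using sect_delta_append[of v "[]" g] by simp

lemma sect_delta_other:
  "length v = length w \<Longrightarrow> v \<noteq> w \<Longrightarrow> sect (delta v g) w = \<one>\<^bsub>Aut_tree\<^esub>"
  by (auto simp: sect_def delta_def Aut_tree_def fun_eq_iff prefix_def append_eq_append_conv)

lemma delta_delta: "delta v (delta w g) = delta (v @ w) g"
  by (rule ext) (auto simp: delta_def prefix_def)

lemma act_delta_other: "\<not> prefix v u \<Longrightarrow> act (delta v g) u = u"
proof (induction u rule: rev_induct)
  case (snoc x u)
  then show ?case by (auto simp: act_snoc delta_def prefix_snoc)
qed simp

lemma act_delta_short: "length u \<le> length v \<Longrightarrow> act (delta v g) u = u"
  using act_delta_other[of v u g] act_delta[of v g "[]"]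
  by (cases "prefix v u") (auto simp: prefix_def)

lemma delta_mult: "delta v (f \<odot> g) = delta v f \<odot> delta v g"
proof (rule act_eq_imp_eq, rule ext)
  fix u show "act (delta v (f \<odot> g)) u = act (delta v f \<odot> delta v g) u"
    by (cases "prefix v u") (auto simp: prefix_def act_mult act_delta act_delta_other)
qed

lemma delta_one [simp]: "delta v \<one>\<^bsub>Aut_tree\<^esub> = \<one>\<^bsub>Aut_tree\<^esub>"
  by (auto simp: delta_def Aut_tree_def)

lemma delta_inv: "g \<in> carrier Aut_tree \<Longrightarrow> delta v (aut_inv g) = aut_inv (delta v g)"
  using delta_mult[of v "aut_inv g" g] by (simp add: Aut.inv_equality)

text \<open>
  Together with self-similarity, this is how conjugation by \<open>G\<close> moves the conditions
  \<open>\<delta>\<^sub>v(k) \<in> G\<close> around within a level.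
\<close>
lemma conj_delta:
  assumes g: "g \<in> carrier Aut_tree" and k: "k \<in> carrier Aut_tree"
  shows "g \<odot> delta v k \<odot> aut_inv g
    = delta (act g v) (sect g v \<odot> k \<odot> aut_inv (sect g v))" (is "?l = delta ?w ?k")
proof -
  have "g \<odot> delta v k = delta ?w ?k \<odot> g"
  proof (rule act_eq_imp_eq, rule ext)
    fix u
    show "act (g \<odot> delta v k) u = act (delta ?w ?k \<odot> g) u"
    proof (cases "prefix v u")
      case True
      then obtain t where u: "u = v @ t" by (auto simp: prefix_def)
      have "act (g \<odot> delta v k) u = ?w @ act (sect g v) (act k t)"
        unfolding u act_mult act_delta act_append[of g] ..
      moreover have "act (delta ?w ?k \<odot> g) u = ?w @ act ?k (act (sect g v) t)"
        unfolding u act_mult act_append[of g] act_delta ..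
      ultimately show ?thesis using g by (simp add: act_mult)
    next
      case False
      then show ?thesis using g by (simp add: act_mult act_delta_other prefix_act_iff)
    qed
  qed
  then show ?thesis using g k by (simp add: Aut.m_assoc)
qed


definition fixes_level :: "nat \<Rightarrow> 'x portrait \<Rightarrow> bool" where
  "fixes_level n g \<longleftrightarrow> (\<forall>u\<in>level n. act g u = u)"

text \<open>
  The set \<open>A v\<close> may vary with \<open>v\<close>: both \<open>Rst_level G n\<close> and \<open>n \<star> K\<close> are of this form, and the
  level-wise description replaces the ordered products of their definitions.
\<close>
definition with_sections :: "nat \<Rightarrow> ('x list \<Rightarrow> 'x portrait set) \<Rightarrow> 'x portrait set" where
  "with_sections n A =
     {g \<in> carrier Aut_tree. fixes_level n g \<and> (\<forall>v\<in>level n. sect g v \<in> A v)}"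

lemma fixes_levelD: "fixes_level n g \<Longrightarrow> length u \<le> n \<Longrightarrow> act g u = u"
proof -
  assume f: "fixes_level n g" and l: "length u \<le> n"
  then have "act g (u @ replicate (n - length u) undefined) = u @ replicate (n - length u) undefined"
    by (auto simp: fixes_level_def level_def)
  then show "act g u = u" by (simp add: act_append)
qed

lemma fixes_level_mono: "fixes_level n g \<Longrightarrow> m \<le> n \<Longrightarrow> fixes_level m g"
  unfolding fixes_level_def[of m] by (auto simp: level_def intro: fixes_levelD)

text \<open>
  By this equivalence, conditions on a deep level are checked on the sections at a higher one.
\<close>
lemma fixes_level_add:
  "fixes_level (n + m) g \<longleftrightarrow> fixes_level n g \<and> (\<forall>v\<in>level n. fixes_level m (sect g v))"
proof
  assume f: "fixes_level (n + m) g"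
  then have n: "fixes_level n g" by (rule fixes_level_mono) simp
  have "act (sect g v) w = w" if "v \<in> level n" "w \<in> level m" for v w
  proof -
    have "act g (v @ w) = v @ w" using f that by (simp add: fixes_level_def level_def)
    then show ?thesis by (simp add: act_append)
  qed
  with n show "fixes_level n g \<and> (\<forall>v\<in>level n. fixes_level m (sect g v))"
    by (auto simp: fixes_level_def)
next
  assume r: "fixes_level n g \<and> (\<forall>v\<in>level n. fixes_level m (sect g v))"
  show "fixes_level (n + m) g"
    unfolding fixes_level_def
  proof
    fix u :: "'a list" assume "u \<in> level (n + m)"
    then have "take n u \<in> level n" "drop n u \<in> level m" by (auto simp: level_def)
    then have "act g (take n u @ drop n u) = take n u @ drop n u"
      unfolding act_append using r by (auto simp: fixes_level_def)
    then show "act g u = u" by simp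
  qed
qed

lemma eq_if_sections_eq:
  assumes f: "fixes_level n f" and g: "fixes_level n g"
    and s: "\<And>v. v \<in> level n \<Longrightarrow> sect f v = sect g v"
  shows "f = g"
proof (rule act_eq_imp_eq, rule ext)
  fix u show "act f u = act g u"
  proof (cases "length u \<le> n")
    case True then show ?thesis using f g by (simp add: fixes_levelD)
  next
    case False
    then have t: "take n u \<in> level n" by (simp add: level_def)
    have "act f (take n u @ drop n u) = act g (take n u @ drop n u)"
      unfolding act_append using f g s[OF t] t by (simp add: fixes_level_def)
    then show ?thesis by simp
  qed
qed

lemma finite_level: "finite (level n :: 'x::finite list set)"
  using finite_lists_length_eq[of "UNIV :: 'x set" n] by (simp add: level_def)

text \<open>
  The factors \<open>\<delta>\<^sub>v(k v)\<close> act on disjoint subtrees, so each of them contributes exactly one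
  section to the product, whatever the order.
\<close>
lemma foldr_delta:
  fixes k :: "'x list \<Rightarrow> 'x portrait"
  assumes "\<And>v. v \<in> level n \<Longrightarrow> h v = delta v (k v)" "\<And>v. v \<in> level n \<Longrightarrow> k v \<in> carrier Aut_tree"
    and "distinct js" "set js \<subseteq> level n"
  defines "p \<equiv> foldr (\<lambda>v y. h v \<odot> y) js \<one>\<^bsub>Aut_tree\<^esub>"
  shows "p \<in> carrier Aut_tree \<and> fixes_level n p \<and>
    (\<forall>w\<in>level n. sect p w = (if w \<in> set js then k w else \<one>\<^bsub>Aut_tree\<^esub>))"
  using assms(3,4) unfolding p_def
proof (induction js)
  case Nil
  then show ?case by (simp add: fixes_level_def)
next
  case (Cons v js)
  let ?q = "foldr (\<lambda>v y. h v \<odot> y) js \<one>\<^bsub>Aut_tree\<^esub>"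
  have q: "?q \<in> carrier Aut_tree" "fixes_level n ?q"
    "\<forall>w\<in>level n. sect ?q w = (if w \<in> set js then k w else \<one>\<^bsub>Aut_tree\<^esub>)"
    using Cons by auto
  have v: "v \<in> level n" "v \<notin> set js" using Cons.prems by auto
  have kv: "k v \<in> carrier Aut_tree" using assms(2) v by blast
  have d: "act (delta v g) w = w" if "w \<in> level n" for g w
    using that v by (intro act_delta_short) (auto simp: level_def)
  have "sect (delta v (k v)) w = (if w = v then k v else \<one>\<^bsub>Aut_tree\<^esub>)" if "w \<in> level n" for w
    using that v by (auto simp: level_def intro: sect_delta_other)
  then show ?case using q v kv d assms(1,2) Cons.prems
    by (auto simp: fixes_level_def act_mult sect_mult)
qed

lemma internal_prod_delta:
  fixes A :: "'x::finite list \<Rightarrow> 'x portrait set"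
  assumes A: "\<And>v. v \<in> level n \<Longrightarrow> A v \<subseteq> carrier Aut_tree"
  shows "internal_prod Aut_tree (level n) (\<lambda>v. delta v ` A v) = with_sections n A"
proof (intro equalityI subsetI)
  fix g assume "g \<in> internal_prod Aut_tree (level n) (\<lambda>v. delta v ` A v)"
  then obtain h js where g: "g = foldr (\<lambda>i y. h i \<odot> y) js \<one>\<^bsub>Aut_tree\<^esub>"
    and js: "distinct js" "set js = level n" and h: "\<forall>v\<in>level n. h v \<in> delta v ` A v"
    by (auto simp: internal_prod_def)
  from h have "\<forall>v\<in>level n. \<exists>k. h v = delta v k \<and> k \<in> A v" by blast
  from bchoice[OF this] obtain k where k: "\<And>v. v \<in> level n \<Longrightarrow> h v = delta v (k v) \<and> k v \<in> A v"
    by blast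
  have kc: "\<And>v. v \<in> level n \<Longrightarrow> k v \<in> carrier Aut_tree" using k A by blast
  show "g \<in> with_sections n A"
  proof -
    have "\<And>v. v \<in> level n \<Longrightarrow> h v = delta v (k v)" using k by blast
    from foldr_delta[OF this kc js(1)] js(2) k show ?thesis
      unfolding with_sections_def g by (simp (no_asm_simp))
  qed
next
  fix g assume g: "g \<in> with_sections n A"
  obtain js where js: "distinct js" "set js = (level n :: 'x list set)"
    using finite_distinct_list[OF finite_level] by blast
  define h where "h v = delta v (sect g v)" for v
  let ?p = "foldr (\<lambda>v y. h v \<odot> y) js \<one>\<^bsub>Aut_tree\<^esub>"
  have "?p = g"
  proof (rule eq_if_sections_eq[where n = n])
    show "fixes_level n g" using g by (simp add: with_sections_def)
    have "sect g v \<in> carrier Aut_tree" for v using g by (simp add: with_sections_def)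
    from foldr_delta[OF h_def this js(1) equalityD1[OF js(2)]] js(2)
    show "fixes_level n ?p" "\<And>v. v \<in> level n \<Longrightarrow> sect ?p v = sect g v" by simp_all
  qed
  moreover have "\<forall>v\<in>level n. h v \<in> delta v ` A v" using g by (auto simp: h_def with_sections_def)
  ultimately show "g \<in> internal_prod Aut_tree (level n) (\<lambda>v. delta v ` A v)"
    using js unfolding internal_prod_def by blast
qed

lemma internal_prod_closed:
  assumes "subgroup G Aut_tree" "\<And>v. v \<in> I \<Longrightarrow> H v \<subseteq> G"
  shows "internal_prod Aut_tree I H \<subseteq> G"
proof
  fix g assume "g \<in> internal_prod Aut_tree I H"
  then obtain h js where g: "g = foldr (\<lambda>i y. h i \<odot> y) js \<one>\<^bsub>Aut_tree\<^esub>"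
    and js: "set js = I" and h: "\<forall>v\<in>I. h v \<in> H v"
    by (auto simp: internal_prod_def)
  have "set js \<subseteq> I \<Longrightarrow> foldr (\<lambda>i y. h i \<odot> y) js \<one>\<^bsub>Aut_tree\<^esub> \<in> G"
    using h assms by (induction js) (auto intro: subgroup.m_closed subgroup.one_closed)
  then show "g \<in> G" using g js by simp
qed

lemma with_sections_realise:
  fixes k :: "'x::finite list \<Rightarrow> 'x portrait"
  assumes "\<And>v. v \<in> level n \<Longrightarrow> k v \<in> carrier Aut_tree"
  obtains g where "g \<in> carrier Aut_tree" "fixes_level n g" "\<And>v. v \<in> level n \<Longrightarrow> sect g v = k v"
proof -
  obtain js where js: "distinct js" "set js = (level n :: 'x list set)"
    using finite_distinct_list[OF finite_level] by blast
  show thesis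
    by (rule that[of "foldr (\<lambda>v y. delta v (k v) \<odot> y) js \<one>\<^bsub>Aut_tree\<^esub>"])
       (use foldr_delta[of n "\<lambda>v. delta v (k v)" k js] assms js in auto)
qed

lemma fixes_level_mult: "fixes_level n f \<Longrightarrow> fixes_level n g \<Longrightarrow> fixes_level n (f \<odot> g)"
  by (simp add: fixes_level_def act_mult)

lemma fixes_level_one [simp]: "fixes_level n \<one>\<^bsub>Aut_tree\<^esub>"
  by (simp add: fixes_level_def)

lemma fixes_level_inv:
  fixes g :: "'x portrait"
  assumes "g \<in> carrier Aut_tree" "fixes_level n g"
  shows "fixes_level n (aut_inv g)"
  unfolding fixes_level_def
proof
  fix u :: "'x list" assume "u \<in> level n"
  then have "act g u = u" using assms by (simp add: fixes_level_def)
  then show "act (aut_inv g) u = u" using act_inv_act[OF assms(1), of u] by (simp only:)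
qed

lemma fixes_level_conj:
  "g \<in> carrier Aut_tree \<Longrightarrow> fixes_level n h \<Longrightarrow> fixes_level n (g \<odot> h \<odot> aut_inv g)"
  by (simp add: fixes_level_def act_mult)

lemma sect_mult_fixes:
  "fixes_level n g \<Longrightarrow> v \<in> level n \<Longrightarrow> sect (f \<odot> g) v = sect f v \<odot> sect g v"
  by (simp add: sect_mult fixes_level_def)

lemma sect_inv_fixes:
  "g \<in> carrier Aut_tree \<Longrightarrow> fixes_level n g \<Longrightarrow> v \<in> level n \<Longrightarrow> sect (aut_inv g) v = aut_inv (sect g v)"
  using fixes_level_inv[of g n] by (simp add: sect_inv fixes_level_def)

lemma sect_conj:
  assumes "g \<in> carrier Aut_tree" "fixes_level n h" "v \<in> level n"
  defines "w \<equiv> act (aut_inv g) v"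
  shows "sect (g \<odot> h \<odot> aut_inv g) v = sect g w \<odot> sect h w \<odot> aut_inv (sect g w)"
proof -
  have "act h w = w" using assms by (simp add: fixes_level_def w_def)
  then show ?thesis using assms(1) by (simp add: sect_mult sect_inv w_def)
qed

lemma subgroup_with_sections:
  assumes "\<And>v. v \<in> level n \<Longrightarrow> subgroup (A v) Aut_tree"
  shows "subgroup (with_sections n A) Aut_tree"
proof (rule Aut.subgroupI)
  show "with_sections n A \<noteq> {}"
    using assms[THEN subgroup.one_closed] by (auto simp: with_sections_def intro!: exI[of _ "\<one>\<^bsub>Aut_tree\<^esub>"])
  show "aut_inv g \<in> with_sections n A" if "g \<in> with_sections n A" for g
    using that subgroup.m_inv_closed[OF assms]
    by (simp add: with_sections_def fixes_level_inv sect_inv_fixes[of g n])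
  show "f \<odot> g \<in> with_sections n A" if "f \<in> with_sections n A" "g \<in> with_sections n A" for f g
    using that subgroup.m_closed[OF assms]
    by (simp add: with_sections_def fixes_level_mult sect_mult_fixes[of n])
qed (auto simp: with_sections_def)

text \<open>
  Grafting \<open>k\<close> at \<open>t\<close> moves its sections from the vertices \<open>w\<close> to \<open>t @ w\<close> and leaves trivial
  sections elsewhere.
\<close>
lemma delta_with_sections:
  assumes k: "k \<in> with_sections j (\<lambda>w. A (t @ w))"
    and one: "\<And>u. u \<in> level (length t + j) \<Longrightarrow> \<one>\<^bsub>Aut_tree\<^esub> \<in> A u"
  shows "delta t k \<in> with_sections (length t + j) A"
proof -
  have "fixes_level (length t + j) (delta t k)"
    unfolding fixes_level_add
  proof (intro conjI ballI)
    show "fixes_level (length t) (delta t k)"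
      unfolding fixes_level_def by (auto simp: level_def intro: act_delta_short)
    show "fixes_level j (sect (delta t k) v)" if "v \<in> level (length t)" for v
      using that k sect_delta_other[of t v k] by (cases "v = t") (auto simp: level_def with_sections_def)
  qed
  moreover have "sect (delta t k) u \<in> A u" if u: "u \<in> level (length t + j)" for u
  proof -
    define v w where "v = take (length t) u" and "w = drop (length t) u"
    have vw: "u = v @ w" "length v = length t" "w \<in> level j"
      using u by (auto simp: v_def w_def level_def)
    have s: "sect (delta t k) u = sect (sect (delta t k) v) w" by (simp add: vw)
    show ?thesis
    proof (cases "v = t")
      case True
      then have "sect (delta t k) u = sect k w" by (simp only: s sect_delta_same)
      then show ?thesis using k vw True by (simp add: with_sections_def)
    next
      case False
      then have "sect (delta t k) v = \<one>\<^bsub>Aut_tree\<^esub>" using vw sect_delta_other[of t v k] by simp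
      then have "sect (delta t k) u = \<one>\<^bsub>Aut_tree\<^esub>" by (simp only: s sect_one)
      then show ?thesis using one[OF u] by simp
    qed
  qed
  ultimately show ?thesis using k by (simp add: with_sections_def)
qed

section \<open>Rigid stabilisers and the maximal branching subgroup\<close>

locale regular_branch_group =
  fixes G :: "'x::finite portrait set"
  assumes subgroup_G: "subgroup G Aut_tree"
    and self_similar_G: "self_similar G"
    and level_transitive_G: "level_transitive G"
    and regular_branch_G: "regular_branch G"
begin

abbreviation K :: "'x portrait set" where "K \<equiv> max_branching G"

lemma G_carrier [simp]: "g \<in> G \<Longrightarrow> g \<in> carrier Aut_tree"
  using subgroup.subset[OF subgroup_G] by blast

lemma G_mult [simp]: "f \<in> G \<Longrightarrow> g \<in> G \<Longrightarrow> f \<odot> g \<in> G"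
  by (rule subgroup.m_closed[OF subgroup_G])

lemma G_inv [simp]: "g \<in> G \<Longrightarrow> aut_inv g \<in> G"
  by (rule subgroup.m_inv_closed[OF subgroup_G])

lemma G_one [simp]: "\<one>\<^bsub>Aut_tree\<^esub> \<in> G"
  by (rule subgroup.one_closed[OF subgroup_G])

lemma G_sect [simp]: "g \<in> G \<Longrightarrow> sect g v \<in> G"
  using self_similar_G by (simp add: self_similar_def)

lemma St_iff: "g \<in> St G n \<longleftrightarrow> g \<in> G \<and> fixes_level n g"
  by (simp add: St_def fixes_level_def)

text \<open>
  This is \<open>(Rst\<^sub>G(v))\<^sub>v\<close>, see \<open>Rst_eq\<close> below.
\<close>
definition rigid_sect :: "'x list \<Rightarrow> 'x portrait set" where
  "rigid_sect v = {k \<in> carrier Aut_tree. delta v k \<in> G}"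

lemma rigid_sect_subset_G: "rigid_sect v \<subseteq> G"
proof
  fix k assume "k \<in> rigid_sect v"
  then have "sect (delta v k) v \<in> G" by (intro G_sect) (simp add: rigid_sect_def)
  then show "k \<in> G" by simp
qed

lemma subgroup_rigid_sect: "subgroup (rigid_sect v) Aut_tree"
proof (rule Aut.subgroupI)
  have "\<one>\<^bsub>Aut_tree\<^esub> \<in> rigid_sect v" by (simp add: rigid_sect_def)
  then show "rigid_sect v \<noteq> {}" by blast
qed (auto simp: rigid_sect_def delta_mult delta_inv)

text \<open>
  Taking the section at \<open>w\<close> turns \<open>\<delta>\<^sub>w\<^sub>v(k)\<close> into \<open>\<delta>\<^sub>v(k)\<close>, and \<open>G\<close> is self-similar.
\<close>
lemma rigid_sect_append: "rigid_sect (w @ v) \<subseteq> rigid_sect v"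
proof
  fix k assume k: "k \<in> rigid_sect (w @ v)"
  then have "sect (delta (w @ v) k) w \<in> G" by (intro G_sect) (simp add: rigid_sect_def)
  then show "k \<in> rigid_sect v" using k by (simp add: sect_delta_append rigid_sect_def)
qed

text \<open>
  By level-transitivity all these groups at one level are conjugate; since the conjugating
  element is a section of \<open>g\<close>, they need not be equal.
\<close>
lemma rigid_sect_conj:
  assumes g: "g \<in> G" and k: "k \<in> rigid_sect v"
  shows "sect g v \<odot> k \<odot> aut_inv (sect g v) \<in> rigid_sect (act g v)"
proof -
  have "g \<odot> delta v k \<odot> aut_inv g \<in> G" using g k by (simp add: rigid_sect_def)
  then show ?thesis using g k conj_delta[of g k v] by (simp add: rigid_sect_def)
qed

text \<open>
  An element that fixes every vertex outside the subtree at \<open>v\<close> also fixes \<open>v\<close>, because it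
  permutes the level of \<open>v\<close>; hence it is determined by its section at \<open>v\<close>.
\<close>
lemma Rst_eq: "Rst G v = delta v ` rigid_sect v"
proof (intro equalityI subsetI)
  fix g assume g: "g \<in> Rst G v"
  then have gG: "g \<in> G" and fx: "\<And>u. \<not> prefix v u \<Longrightarrow> act g u = u" by (auto simp: Rst_def)
  define w where "w = act (aut_inv g) v"
  have w: "act g w = v" "length w = length v" using gG by (simp_all add: w_def)
  have "prefix v w"
  proof (rule ccontr)
    assume n: "\<not> prefix v w"
    then have "w = v" using fx[OF n] w by simp
    with n show False by simp
  qed
  then have "v = w" using w(2) by (auto simp: prefix_def)
  then have gv: "act g v = v" using w(1) by simp
  have "g = delta v (sect g v)"
  proof (rule act_eq_imp_eq, rule ext)
    fix u show "act g u = act (delta v (sect g v)) u"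
      by (cases "prefix v u") (auto simp: prefix_def act_append[of g] act_delta gv act_delta_other fx)
  qed
  moreover from this have "delta v (sect g v) \<in> G" using gG by simp
  ultimately show "g \<in> delta v ` rigid_sect v" using gG by (auto simp: rigid_sect_def)
qed (auto simp: Rst_def rigid_sect_def act_delta_other)

lemma Rst_level_eq: "Rst_level G n = with_sections n rigid_sect"
proof -
  have "Rst G = (\<lambda>v. delta v ` rigid_sect v)" by (rule ext) (rule Rst_eq)
  then show ?thesis unfolding Rst_level_def
    using internal_prod_delta[of n rigid_sect] by (simp add: rigid_sect_def)
qed

lemma Rst_level_subset_G: "Rst_level G n \<subseteq> G"
  unfolding Rst_level_def by (rule internal_prod_closed[OF subgroup_G]) (auto simp: Rst_def)

lemma Rst_level_fixes: "g \<in> Rst_level G n \<Longrightarrow> fixes_level n g"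
  by (simp add: Rst_level_eq with_sections_def)

lemma subgroup_Rst_level: "subgroup (Rst_level G n) Aut_tree"
  unfolding Rst_level_eq by (rule subgroup_with_sections) (rule subgroup_rigid_sect)

text \<open>
  The grafted element is a product of elements \<open>\<delta>\<^sub>t\<^sub>w(\<dots>)\<close> of \<open>G\<close>. This is the main criterion
  for membership in \<open>A\<^sub>t\<close> and, used for all \<open>t\<close> at once, in \<open>K\<close>.
\<close>
lemma delta_in_G:
  assumes "k \<in> with_sections j (\<lambda>w. rigid_sect (t @ w))"
  shows "delta t k \<in> G"
proof -
  have "delta t k \<in> with_sections (length t + j) rigid_sect"
    using assms subgroup.one_closed[OF subgroup_rigid_sect] by (rule delta_with_sections)
  then show ?thesis using Rst_level_subset_G unfolding Rst_level_eq by blast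
qed

lemma Rst_level_add_subset: "Rst_level G (n + j) \<subseteq> Rst_level G n"
proof
  fix g assume g: "g \<in> Rst_level G (n + j)"
  then have gc: "g \<in> carrier Aut_tree" "fixes_level (n + j) g"
    "\<And>v. v \<in> level (n + j) \<Longrightarrow> sect g v \<in> rigid_sect v"
    by (auto simp: Rst_level_eq with_sections_def)
  have "sect g v \<in> rigid_sect v" if v: "v \<in> level n" for v
  proof -
    have "sect g v \<in> with_sections j (\<lambda>w. rigid_sect (v @ w))"
      using gc v by (simp add: with_sections_def fixes_level_add) (simp add: level_def)
    then show ?thesis using gc(1) delta_in_G by (simp add: rigid_sect_def)
  qed
  then show "g \<in> Rst_level G n"
    using gc by (simp add: Rst_level_eq with_sections_def fixes_level_add)
qed

lemma Rst_level_antimono: "m \<le> n \<Longrightarrow> Rst_level G n \<subseteq> Rst_level G m"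
  using Rst_level_add_subset[of m "n - m"] by simp

lemma max_branching_eq: "K = (\<Inter>v. rigid_sect v)"
  unfolding max_branching_def Rst_eq by (simp add: image_image)

lemma K_iff: "k \<in> K \<longleftrightarrow> (\<forall>v. delta v k \<in> G)"
proof -
  have "k \<in> G" if "\<forall>v. delta v k \<in> G" using that[rule_format, of "[]"] by simp
  then show ?thesis by (auto simp: max_branching_eq rigid_sect_def)
qed

lemma K_subset_rigid_sect: "K \<subseteq> rigid_sect v"
  by (auto simp: max_branching_eq)

lemma K_subset_G: "K \<subseteq> G"
  using K_subset_rigid_sect rigid_sect_subset_G by blast

lemma subgroup_K: "subgroup K Aut_tree"
  unfolding max_branching_eq by (rule Aut.subgroups_Inter) (auto simp: subgroup_rigid_sect)

lemma level_prod_K: "n \<star> K = with_sections n (\<lambda>_. K)"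
  unfolding level_prod_def by (rule internal_prod_delta) (use K_subset_G in auto)

lemma level_prod_K_iff:
  "k \<in> n \<star> K \<longleftrightarrow> k \<in> carrier Aut_tree \<and> fixes_level n k \<and> (\<forall>v\<in>level n. sect k v \<in> K)"
  by (simp add: level_prod_K with_sections_def)

lemma subgroup_level_prod_K: "subgroup (n \<star> K) Aut_tree"
  unfolding level_prod_K by (rule subgroup_with_sections) (rule subgroup_K)

lemma level_prod_K_subset_Rst_level: "n \<star> K \<subseteq> Rst_level G n"
  unfolding level_prod_K Rst_level_eq using K_subset_rigid_sect by (auto simp: with_sections_def)

lemma level_prod_K_subset_G: "n \<star> K \<subseteq> G"
  using level_prod_K_subset_Rst_level Rst_level_subset_G by blast

text \<open>
  \<open>G\<close> branches over \<open>K\<close>.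
\<close>
lemma level_prod_K_subset_K: "n \<star> K \<subseteq> K"
proof
  fix k assume "k \<in> n \<star> K"
  then have "k \<in> with_sections n (\<lambda>w. rigid_sect (t @ w))" for t
    using K_subset_rigid_sect unfolding level_prod_K by (auto simp: with_sections_def)
  then show "k \<in> K" using delta_in_G by (auto simp: K_iff)
qed

lemma level_prod_K_add: "k \<in> (m + j) \<star> K \<Longrightarrow> v \<in> level m \<Longrightarrow> sect k v \<in> j \<star> K"
  by (simp add: level_prod_K_iff fixes_level_add) (simp add: level_def)

lemma level_prod_K_antimono:
  assumes "m \<le> n" shows "n \<star> K \<subseteq> m \<star> K"
proof
  fix k assume k: "k \<in> n \<star> K"
  then have "sect k v \<in> K" if "v \<in> level m" for v
    using level_prod_K_add[of k m "n - m" v] that assms level_prod_K_subset_K by auto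
  then show "k \<in> m \<star> K" using k assms fixes_level_mono by (auto simp: level_prod_K_iff)
qed

lemma normal_Rst_level: "Rst_level G n \<lhd> as_group G"
proof (rule group.normal_invI)
  show "group (as_group G)" by (rule Aut.subgroup_imp_group[OF subgroup_G])
  show "subgroup (Rst_level G n) (as_group G)"
    by (rule Aut.subgroup_incl[OF subgroup_Rst_level subgroup_G Rst_level_subset_G])
  fix g h assume "g \<in> carrier (as_group G)" and h: "h \<in> Rst_level G n"
  then have g: "g \<in> G" by simp
  have hc: "h \<in> carrier Aut_tree" "fixes_level n h" using h by (auto simp: Rst_level_eq with_sections_def)
  have "sect (g \<odot> h \<odot> aut_inv g) v \<in> rigid_sect v" if "v \<in> level n" for v
  proof -
    define w where "w = act (aut_inv g) v"
    have "w \<in> level n" "act g w = v" using that g by (simp_all add: w_def)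
    then have "sect h w \<in> rigid_sect w" using h by (auto simp: Rst_level_eq with_sections_def)
    from rigid_sect_conj[OF g this] show ?thesis
      using sect_conj[of g n h v] g hc that \<open>act g w = v\<close> by (simp add: w_def)
  qed
  then have "g \<odot> h \<odot> aut_inv g \<in> Rst_level G n"
    using g hc by (simp add: Rst_level_eq with_sections_def fixes_level_conj)
  then show "g \<otimes>\<^bsub>as_group G\<^esub> h \<otimes>\<^bsub>as_group G\<^esub> inv\<^bsub>as_group G\<^esub> g \<in> Rst_level G n"
    using g subgroup_G by simp
qed

lemma r_coset_as_group [simp]: "r_coset (as_group B) H g = r_coset Aut_tree H g"
  by (simp add: r_coset_def)

lemma set_mult_as_group [simp]: "set_mult (as_group B) = set_mult Aut_tree"
  by (simp add: set_mult_def fun_eq_iff)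

text \<open>
  A subgroup over which \<open>G\<close> branches satisfies \<open>\<delta>\<^sub>v(H) \<subseteq> H \<subseteq> G\<close> for all \<open>v\<close>, that is, \<open>H \<subseteq> K\<close>.
\<close>
lemma branching_subgroup_exists:
  obtains H where "H \<lhd> as_group G" "finite (rcosets\<^bsub>as_group G\<^esub> H)" "H \<subseteq> K"
proof -
  from regular_branch_G obtain H where H: "H \<lhd> as_group G" "finite (rcosets\<^bsub>as_group G\<^esub> H)" "1 \<star> H \<subseteq> H"
    unfolding regular_branch_def by blast
  have "subgroup H (as_group G)" using H(1) by (rule normal_imp_subgroup)
  then have HG: "H \<subseteq> G" and one: "\<one>\<^bsub>Aut_tree\<^esub> \<in> H"
    using subgroup.subset subgroup.one_closed by fastforce+
  have ls: "1 \<star> H = with_sections 1 (\<lambda>_. H)"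
    unfolding level_prod_def by (rule internal_prod_delta) (use HG in auto)
  have d: "delta v h \<in> H" if "h \<in> H" for v h
    using that
  proof (induction v)
    case (Cons x v)
    have "delta v h \<in> with_sections 0 (\<lambda>_. H)"
      using Cons HG by (auto simp: with_sections_def fixes_level_def level_def)
    then have "delta [x] (delta v h) \<in> 1 \<star> H"
      using delta_with_sections[of "delta v h" 0 "\<lambda>_. H" "[x]"] one by (simp add: ls[unfolded One_nat_def])
    then show ?case using H(3) by (auto simp: delta_delta)
  qed simp
  have "H \<subseteq> K"
  proof
    fix h assume "h \<in> H"
    then have "\<forall>v. delta v h \<in> G" using d HG by blast
    then show "h \<in> K" by (simp add: K_iff)
  qed
  with H that show thesis by blast
qed

lemma finite_index_K: "finite (carrier (as_group G Mod K))"
proof -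
  obtain H where H: "H \<lhd> as_group G" "finite (rcosets\<^bsub>as_group G\<^esub> H)" "H \<subseteq> K"
    by (rule branching_subgroup_exists)
  have "subgroup H (as_group G)" using H(1) by (rule normal_imp_subgroup)
  then have one: "\<one>\<^bsub>Aut_tree\<^esub> \<in> H" and HG: "H \<subseteq> G"
    using subgroup.one_closed subgroup.subset by fastforce+
  have KH: "K <#>\<^bsub>Aut_tree\<^esub> H = K"
  proof
    show "K <#>\<^bsub>Aut_tree\<^esub> H \<subseteq> K"
      using H(3) subgroup.m_closed[OF subgroup_K] by (auto simp: set_mult_def)
    show "K \<subseteq> K <#>\<^bsub>Aut_tree\<^esub> H"
    proof
      fix k assume k: "k \<in> K"
      then have "k = k \<odot> \<one>\<^bsub>Aut_tree\<^esub>" using K_subset_G by auto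
      then show "k \<in> K <#>\<^bsub>Aut_tree\<^esub> H" using one k unfolding set_mult_def by blast
    qed
  qed
  have "K #>\<^bsub>Aut_tree\<^esub> g = K <#>\<^bsub>Aut_tree\<^esub> (H #>\<^bsub>Aut_tree\<^esub> g)" if "g \<in> G" for g
    using Aut.setmult_rcos_assoc[of K H g] that HG K_subset_G G_carrier by (simp add: KH subset_iff)
  then have "carrier (as_group G Mod K) \<subseteq> (\<lambda>C. K <#>\<^bsub>Aut_tree\<^esub> C) ` (rcosets\<^bsub>as_group G\<^esub> H)"
    by (auto simp: carrier_FactGroup RCOSETS_def)
  then show ?thesis using H(2) finite_surj by blast
qed

section \<open>Cofinality of rigid stabilisers and level products of K\<close>


text \<open>
  Measure \<open>A\<^sub>v\<close> by the number of cosets of \<open>H\<close> in it, for a normal subgroup \<open>H \<subseteq> K\<close> of finite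
  index. This number is the same for all \<open>v\<close> of one length, by conjugacy, and does not increase
  with the length, by \<open>rigid_sect_append\<close>; beyond a length where it is minimal, the inclusions
  \<open>A\<^sub>w\<^sub>v \<subseteq> A\<^sub>v\<close> are equalities.
\<close>
lemma rigid_sect_eventually_constant:
  obtains N where "\<And>v w. N \<le> length v \<Longrightarrow> rigid_sect v \<subseteq> rigid_sect (w @ v)"
proof -
  obtain H where H: "H \<lhd> as_group G" "finite (rcosets\<^bsub>as_group G\<^esub> H)" "H \<subseteq> K"
    by (rule branching_subgroup_exists)
  interpret GG: group "as_group G" by (rule Aut.subgroup_imp_group[OF subgroup_G])
  interpret H: normal H "as_group G" by (rule H(1))
  have HG: "H \<subseteq> G" using H.subset by simp
  have sH: "subgroup H Aut_tree" using Aut.incl_subgroup[OF subgroup_G] H.is_subgroup by blast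
  define cosets where "cosets v = (\<lambda>k. H #>\<^bsub>Aut_tree\<^esub> k) ` rigid_sect v" for v
  have fin: "finite (cosets v)" for v
  proof (rule finite_subset[OF _ H(2)])
    show "cosets v \<subseteq> rcosets\<^bsub>as_group G\<^esub> H"
      using rigid_sect_subset_G[of v] by (auto simp: cosets_def RCOSETS_def)
  qed
  have Union: "rigid_sect v = \<Union> (cosets v)" for v
  proof
    show "rigid_sect v \<subseteq> \<Union> (cosets v)"
    proof
      fix k assume k: "k \<in> rigid_sect v"
      then have "k \<in> H #>\<^bsub>Aut_tree\<^esub> k"
        using rigid_sect_subset_G[of v] by (intro Aut.rcos_self[OF _ sH]) auto
      then show "k \<in> \<Union> (cosets v)" using k unfolding cosets_def by blast
    qed
    show "\<Union> (cosets v) \<subseteq> rigid_sect v"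
      using H(3) K_subset_rigid_sect[of v] subgroup.m_closed[OF subgroup_rigid_sect]
      by (auto simp: cosets_def r_coset_def subset_iff)
  qed
  have le: "card (cosets u) \<le> card (cosets v)" if uv: "length u = length v" for u v
  proof -
    obtain g where g: "g \<in> G" "act g u = v"
      using level_transitive_G uv unfolding level_transitive_def level_def by blast
    define s where "s = sect g u"
    have s: "s \<in> G" using g by (simp add: s_def)
    have cancel: "s \<odot> (aut_inv s \<odot> z) = z" "aut_inv s \<odot> (s \<odot> z) = z" if "z \<in> carrier Aut_tree" for z
      using s that by (simp_all flip: Aut.m_assoc)
    have conj_coset: "(\<lambda>y. s \<odot> y \<odot> aut_inv s) ` (H #>\<^bsub>Aut_tree\<^esub> k)
        = H #>\<^bsub>Aut_tree\<^esub> (s \<odot> k \<odot> aut_inv s)" if k: "k \<in> G" for k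
    proof (intro equalityI subsetI)
      fix y assume "y \<in> (\<lambda>y. s \<odot> y \<odot> aut_inv s) ` (H #>\<^bsub>Aut_tree\<^esub> k)"
      then obtain h where h: "h \<in> H" "y = s \<odot> (h \<odot> k) \<odot> aut_inv s" by (auto simp: r_coset_def)
      have "s \<odot> h \<odot> aut_inv s \<in> H" using H.inv_op_closed2[of s h] s h subgroup_G by simp
      moreover have "y = (s \<odot> h \<odot> aut_inv s) \<odot> (s \<odot> k \<odot> aut_inv s)"
        using h s k HG by (simp add: subset_iff Aut.m_assoc cancel)
      ultimately show "y \<in> H #>\<^bsub>Aut_tree\<^esub> (s \<odot> k \<odot> aut_inv s)" by (auto simp: r_coset_def)
    next
      fix y assume "y \<in> H #>\<^bsub>Aut_tree\<^esub> (s \<odot> k \<odot> aut_inv s)"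
      then obtain h where h: "h \<in> H" "y = h \<odot> (s \<odot> k \<odot> aut_inv s)" by (auto simp: r_coset_def)
      have "aut_inv s \<odot> h \<odot> s \<in> H" using H.inv_op_closed1[of s h] s h subgroup_G by simp
      moreover have "y = s \<odot> ((aut_inv s \<odot> h \<odot> s) \<odot> k) \<odot> aut_inv s"
        using h s k HG by (simp add: subset_iff Aut.m_assoc cancel)
      ultimately show "y \<in> (\<lambda>y. s \<odot> y \<odot> aut_inv s) ` (H #>\<^bsub>Aut_tree\<^esub> k)" by (auto simp: r_coset_def)
    qed
    have inj: "inj_on (\<lambda>y. s \<odot> y \<odot> aut_inv s) G" using s by (auto intro!: inj_onI)
    show ?thesis
    proof (rule card_inj_on_le)
      show "inj_on ((`) (\<lambda>y. s \<odot> y \<odot> aut_inv s)) (cosets u)"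
      proof (rule inj_on_subset[OF inj_on_image_Pow[OF inj]])
        show "cosets u \<subseteq> Pow G" using Union[of u] rigid_sect_subset_G[of u] by blast
      qed
      show "(`) (\<lambda>y. s \<odot> y \<odot> aut_inv s) ` cosets u \<subseteq> cosets v"
      proof
        fix C assume "C \<in> (`) (\<lambda>y. s \<odot> y \<odot> aut_inv s) ` cosets u"
        then obtain k where k: "k \<in> rigid_sect u"
          "C = (\<lambda>y. s \<odot> y \<odot> aut_inv s) ` (H #>\<^bsub>Aut_tree\<^esub> k)"
          by (auto simp: cosets_def)
        then have "C = H #>\<^bsub>Aut_tree\<^esub> (s \<odot> k \<odot> aut_inv s)"
          using conj_coset rigid_sect_subset_G by blast
        then show "C \<in> cosets v"
          using rigid_sect_conj[OF g(1) k(1)] by (auto simp: cosets_def s_def g(2))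
      qed
    qed (rule fin)
  qed
  have ext: "card (cosets (w @ v)) \<le> card (cosets v)" for w v
    using rigid_sect_append[of w v] by (intro card_mono fin) (auto simp: cosets_def)
  obtain v0 where v0: "\<And>v. card (cosets v0) \<le> card (cosets v)"
    using ex_has_least_nat[of "\<lambda>_. True" _ "\<lambda>v. card (cosets v)"] by auto
  show thesis
  proof (rule that[of "length v0"])
    fix v w :: "'x list" assume v: "length v0 \<le> length v"
    \<comment> \<open>Compare \<open>v\<close> with its suffix of the critical length.\<close>
    define a b where "a = take (length v - length v0) v" and "b = drop (length v - length v0) v"
    have ab: "v = a @ b" "length b = length v0" using v by (simp_all add: a_def b_def)
    have "card (cosets v) \<le> card (cosets v0)"
      using ext[of a b] le[OF ab(2)] by (simp add: ab(1))
    then have "card (cosets v) \<le> card (cosets (w @ v))" using v0[of "w @ v"] by simp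
    moreover have "cosets (w @ v) \<subseteq> cosets v" using rigid_sect_append[of w v] by (auto simp: cosets_def)
    ultimately have "cosets (w @ v) = cosets v" by (intro card_seteq fin)
    then show "rigid_sect v \<subseteq> rigid_sect (w @ v)" using Union by (metis order_refl)
  qed
qed

text \<open>
  The length \<open>N\<close> from which on \<open>A\<^sub>v\<close> is unchanged by letters put in front of \<open>v\<close>.
\<close>
definition stable_depth :: nat where
  "stable_depth = (SOME N. \<forall>v w. N \<le> length v \<longrightarrow> rigid_sect v \<subseteq> rigid_sect (w @ v))"

lemma rigid_sect_stable: "stable_depth \<le> length v \<Longrightarrow> rigid_sect v \<subseteq> rigid_sect (w @ v)"
proof -
  have "\<exists>N. \<forall>v w. N \<le> length v \<longrightarrow> rigid_sect v \<subseteq> rigid_sect (w @ v)"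
    using rigid_sect_eventually_constant by metis
  then have "\<forall>v w. stable_depth \<le> length v \<longrightarrow> rigid_sect v \<subseteq> rigid_sect (w @ v)"
    unfolding stable_depth_def by (rule someI_ex)
  then show "stable_depth \<le> length v \<Longrightarrow> rigid_sect v \<subseteq> rigid_sect (w @ v)" by blast
qed

text \<open>
  A section at level \<open>m\<close> of an element of \<open>R\<^sub>n\<close> has its own sections, at words \<open>w\<close> of length at
  least \<open>N\<close>, in \<open>A\<^sub>v\<^sub>w \<subseteq> A\<^sub>w = A\<^sub>t\<^sub>w\<close> for every \<open>t\<close>. So it lies in every \<open>A\<^sub>t\<close>, hence in \<open>K\<close>.
\<close>
lemma Rst_level_subset_level_prod_K:
  assumes "m + stable_depth \<le> n"
  shows "Rst_level G n \<subseteq> m \<star> K"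
proof
  fix g assume g: "g \<in> Rst_level G n"
  define j where "j = n - m"
  have n: "n = m + j" "stable_depth \<le> j" using assms by (auto simp: j_def)
  have gc: "g \<in> carrier Aut_tree" "fixes_level (m + j) g"
    "\<And>v. v \<in> level (m + j) \<Longrightarrow> sect g v \<in> rigid_sect v"
    using g by (auto simp: Rst_level_eq with_sections_def n)
  have "sect g v \<in> K" if v: "v \<in> level m" for v
    unfolding K_iff
  proof
    fix t
    have "sect g (v @ w) \<in> rigid_sect (t @ w)" if w: "w \<in> level j" for w
      using gc(3)[of "v @ w"] v w n rigid_sect_append[of v w] rigid_sect_stable[of w t]
      by (auto simp: level_def)
    then have "sect g v \<in> with_sections j (\<lambda>w. rigid_sect (t @ w))"
      using gc v by (simp add: with_sections_def fixes_level_add)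
    then show "delta t (sect g v) \<in> G" by (rule delta_in_G)
  qed
  then show "g \<in> m \<star> K" using gc by (simp add: level_prod_K_iff fixes_level_add)
qed

lemma subgroup_St: "subgroup (St G n) Aut_tree"
proof (rule Aut.subgroupI)
  have "\<one>\<^bsub>Aut_tree\<^esub> \<in> St G n" by (simp add: St_iff)
  then show "St G n \<noteq> {}" by blast
qed (auto simp: St_iff fixes_level_inv fixes_level_mult)

lemma Rst_level_subset_St: "Rst_level G n \<subseteq> St G n"
  using subsetD[OF Rst_level_subset_G] Rst_level_fixes by (simp add: St_iff subset_iff)

lemma St_sect: "g \<in> St G (n + m) \<Longrightarrow> v \<in> level n \<Longrightarrow> sect g v \<in> St G m"
  by (simp add: St_iff fixes_level_add)

lemma St_antimono: "m \<le> n \<Longrightarrow> St G n \<subseteq> St G m"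
  using fixes_level_mono by (auto simp: St_iff)

section \<open>Elements of the rigid kernel\<close>

text \<open>
  An element of the rigid kernel is the same as a sequence of representatives \<open>g n \<in> S\<^sub>n\<close> that
  agree modulo \<open>R\<^sub>n\<close>. Writing both compatibility conditions as equations between cosets makes
  closure under products and inverses a consequence of \<open>g \<mapsto> R\<^sub>n g\<close> being a homomorphism; the
  rigid kernel is then a subgroup of the full product of the quotients \<open>G/R\<^sub>n\<close>.
\<close>
lemma group_rigid_kernel_and_carrier:
  shows group_rigid_kernel: "group (rigid_kernel G)"
    and carrier_rigid_kernel: "carrier (rigid_kernel G) =
      {s. \<exists>g. \<forall>n. g n \<in> St G n \<and> s n = Rst_level G n #>\<^bsub>Aut_tree\<^esub> g n \<and>
            Rst_level G n #>\<^bsub>Aut_tree\<^esub> g (Suc n) = Rst_level G n #>\<^bsub>Aut_tree\<^esub> g n}"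
    (is "_ = ?C")
proof -
  let ?R = "Rst_level G"
  let ?q = "\<lambda>n g. ?R n #>\<^bsub>Aut_tree\<^esub> g"
  interpret GG: group "as_group G" by (rule Aut.subgroup_imp_group[OF subgroup_G])
  have St_absorb: "St G n <#>\<^bsub>Aut_tree\<^esub> ?q n g = St G n" if "g \<in> St G n" for n g
  proof -
    have "St G n <#>\<^bsub>Aut_tree\<^esub> ?R n = St G n"
      using Aut.set_mult_subgroup_idem[OF subgroup_St] Aut.subgroup_incl[OF subgroup_Rst_level subgroup_St]
        Rst_level_subset_St by blast
    then show ?thesis
      using Aut.setmult_rcos_assoc[of "St G n" "?R n" g] that subgroup.subset[OF subgroup_St]
        subgroup.subset[OF subgroup_Rst_level] Aut.coset_join2[OF _ subgroup_St]
      by (simp add: subset_iff)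
  qed
  have R_absorb: "?R n <#>\<^bsub>Aut_tree\<^esub> ?q (Suc n) g = ?q n g" if "g \<in> G" for n g
  proof -
    have "?R n <#>\<^bsub>Aut_tree\<^esub> ?R (Suc n) = ?R n"
      using Aut.set_mult_subgroup_idem[OF subgroup_Rst_level]
        Aut.subgroup_incl[OF subgroup_Rst_level subgroup_Rst_level] Rst_level_antimono[of n "Suc n"] by simp
    then show ?thesis
      using Aut.setmult_rcos_assoc[of "?R n" "?R (Suc n)" g] that
        subgroup.subset[OF subgroup_Rst_level] by (simp add: subset_iff)
  qed
  have carrier_iff: "s \<in> carrier (rigid_kernel G) \<longleftrightarrow>
      (\<forall>n. s n \<in> (\<lambda>g. ?q n g) ` G \<and> ?R n <#>\<^bsub>Aut_tree\<^esub> s (Suc n) = s n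
         \<and> St G n <#>\<^bsub>Aut_tree\<^esub> s n = St G n)" for s
    by (auto simp: rigid_kernel_def Let_def kernel_def quotient_limit_def inverse_limit_def
        carrier_FactGroup fun_eq_iff)
  show C: "carrier (rigid_kernel G) = ?C"
  proof (intro equalityI subsetI)
    fix s assume s: "s \<in> carrier (rigid_kernel G)"
    then have "s n \<in> ?q n ` G" for n by (simp add: carrier_iff)
    then have "\<forall>n. \<exists>g. g \<in> G \<and> s n = ?q n g" by blast
    then obtain g where g: "\<And>n. g n \<in> G" "\<And>n. s n = ?q n (g n)" by metis
    have "g n \<in> St G n" for n
    proof -
      have "g n \<in> s n" using g Aut.rcos_self[OF _ subgroup_Rst_level] by simp
      then have "\<one>\<^bsub>Aut_tree\<^esub> \<odot> g n \<in> St G n <#>\<^bsub>Aut_tree\<^esub> s n"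
        using subgroup.one_closed[OF subgroup_St] unfolding set_mult_def by blast
      then show ?thesis using s g by (simp add: carrier_iff)
    qed
    moreover have "?q n (g (Suc n)) = ?q n (g n)" for n
      using s g R_absorb[of "g (Suc n)" n] by (simp add: carrier_iff)
    ultimately show "s \<in> ?C" using g by blast
  next
    fix s assume "s \<in> ?C"
    then obtain g where g: "\<And>n. g n \<in> St G n" "\<And>n. s n = ?q n (g n)" "\<And>n. ?q n (g (Suc n)) = ?q n (g n)"
      by blast
    then show "s \<in> carrier (rigid_kernel G)"
      using R_absorb St_absorb by (simp add: carrier_iff St_iff)
  qed
  define P where "P = product_group UNIV (\<lambda>n. as_group G Mod ?R n)"
  have gq: "group (as_group G Mod ?R n)" for n by (rule normal.factorgroup_is_group[OF normal_Rst_level])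
  have gP: "group P" by (simp add: P_def gq)
  have hom: "(\<lambda>g. ?q n g) \<in> hom (as_group G) (as_group G Mod ?R n)" for n
    using normal.r_coset_hom_Mod[OF normal_Rst_level] by simp
  have sub: "subgroup ?C P"
  proof (rule group.subgroupI[OF gP])
    show "?C \<subseteq> carrier P"
      by (auto simp: P_def carrier_FactGroup St_iff PiE_iff)
    have "(\<lambda>n. ?q n \<one>\<^bsub>Aut_tree\<^esub>) \<in> ?C"
      using subgroup.one_closed[OF subgroup_St] by (auto intro!: exI[of _ "\<lambda>_. \<one>\<^bsub>Aut_tree\<^esub>"])
    then show "?C \<noteq> {}" by (intro notI) (simp only: empty_iff)
  next
    fix s assume "s \<in> ?C"
    then obtain g where g: "\<And>n. g n \<in> St G n" "\<And>n. s n = ?q n (g n)" "\<And>n. ?q n (g (Suc n)) = ?q n (g n)"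
      by blast
    have gG: "g n \<in> G" for n using g by (simp add: St_iff)
    have inv: "inv\<^bsub>as_group G Mod ?R n\<^esub> ?q n h = ?q n (aut_inv h)" if "h \<in> G" for n h
      using group_hom.hom_inv[of "as_group G" "as_group G Mod ?R n" "?q n" h] hom gq that subgroup_G
      by (simp add: group_hom_def group_hom_axioms_def GG.group_axioms)
    have "inv\<^bsub>P\<^esub> s = (\<lambda>n. ?q n (aut_inv (g n)))"
      using gG g(2) by (auto simp: P_def gq carrier_FactGroup PiE_iff inv)
    moreover have "?q n (aut_inv (g (Suc n))) = ?q n (aut_inv (g n))" for n
      using inv[OF gG] g(3) by metis
    moreover have "aut_inv (g n) \<in> St G n" for n
      using g subgroup.m_inv_closed[OF subgroup_St] by blast
    ultimately show "inv\<^bsub>P\<^esub> s \<in> ?C"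
      unfolding mem_Collect_eq by (intro exI[of _ "\<lambda>n. aut_inv (g n)"]) simp
  next
    fix s t assume "s \<in> ?C" "t \<in> ?C"
    then obtain g h where g: "\<And>n. g n \<in> St G n" "\<And>n. s n = ?q n (g n)" "\<And>n. ?q n (g (Suc n)) = ?q n (g n)"
      and h: "\<And>n. h n \<in> St G n" "\<And>n. t n = ?q n (h n)" "\<And>n. ?q n (h (Suc n)) = ?q n (h n)"
      by blast
    have gG: "g n \<in> G" "h n \<in> G" for n using g h by (simp_all add: St_iff)
    have m: "?q n a <#>\<^bsub>Aut_tree\<^esub> ?q n b = ?q n (a \<odot> b)" if "a \<in> G" "b \<in> G" for n a b
      using normal.rcos_sum[OF normal_Rst_level, of a b n] that by simp
    have "s \<otimes>\<^bsub>P\<^esub> t = (\<lambda>n. ?q n (g n \<odot> h n))"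
      using gG g(2) h(2) by (auto simp: P_def m restrict_def)
    moreover have "?q n (g (Suc n) \<odot> h (Suc n)) = ?q n (g n \<odot> h n)" for n
      using m[OF gG] g(3) h(3) by metis
    moreover have "g n \<odot> h n \<in> St G n" for n
      using g h subgroup.m_closed[OF subgroup_St] by blast
    ultimately show "s \<otimes>\<^bsub>P\<^esub> t \<in> ?C"
      unfolding mem_Collect_eq by (intro exI[of _ "\<lambda>n. g n \<odot> h n"]) simp
  qed
  have "rigid_kernel G = P\<lparr>carrier := ?C\<rparr>"
    unfolding C[symmetric]
    by (simp add: rigid_kernel_def P_def Let_def quotient_limit_def inverse_limit_def product_group_def restrict_def)
  then show "group (rigid_kernel G)" using subgroup.subgroup_is_group[OF sub gP] by simp
qed


abbreviation RK where "RK \<equiv> rigid_kernel G"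

lemma one_rigid_kernel: "\<one>\<^bsub>RK\<^esub> = Rst_level G"
  by (simp add: rigid_kernel_def Let_def quotient_limit_def inverse_limit_def)

lemma mult_rigid_kernel: "(s \<otimes>\<^bsub>RK\<^esub> t) n = s n <#>\<^bsub>Aut_tree\<^esub> t n"
  by (simp add: rigid_kernel_def Let_def quotient_limit_def inverse_limit_def)

lemma rigid_kernel_component:
  assumes s: "s \<in> carrier RK" and g: "g \<in> s n"
  shows "g \<in> St G n" and "s n = Rst_level G n #>\<^bsub>Aut_tree\<^esub> g"
proof -
  from s obtain h where h: "h \<in> St G n" "s n = Rst_level G n #>\<^bsub>Aut_tree\<^esub> h"
    unfolding carrier_rigid_kernel by blast
  then show "s n = Rst_level G n #>\<^bsub>Aut_tree\<^esub> g"
    using g Aut.repr_independence[OF _ _ subgroup_Rst_level] by (simp add: St_iff)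
  from g h(2) obtain r where "r \<in> Rst_level G n" "g = r \<odot> h" by (auto simp: r_coset_def)
  then show "g \<in> St G n"
    using h(1) Rst_level_subset_St subgroup.m_closed[OF subgroup_St] by blast
qed

lemma rigid_kernel_component_nonempty:
  assumes "s \<in> carrier RK" shows "s n \<noteq> {}"
proof -
  from assms obtain h where h: "h \<in> St G n" "s n = Rst_level G n #>\<^bsub>Aut_tree\<^esub> h"
    unfolding carrier_rigid_kernel by blast
  then have "h \<in> s n" using Aut.rcos_self[OF _ subgroup_Rst_level] by (simp add: St_iff)
  then show ?thesis by blast
qed

lemma rigid_kernel_antimono:
  assumes s: "s \<in> carrier RK" and "m \<le> n"
  shows "s n \<subseteq> s m"
proof (rule lift_Suc_antimono_le[OF _ \<open>m \<le> n\<close>])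
  fix n
  from s obtain g where g: "\<And>n. s n = Rst_level G n #>\<^bsub>Aut_tree\<^esub> g n"
    "\<And>n. Rst_level G n #>\<^bsub>Aut_tree\<^esub> g (Suc n) = Rst_level G n #>\<^bsub>Aut_tree\<^esub> g n"
    unfolding carrier_rigid_kernel by blast
  have "s (Suc n) \<subseteq> Rst_level G n #>\<^bsub>Aut_tree\<^esub> g (Suc n)"
    using Rst_level_antimono[of n "Suc n"] by (auto simp: g(1) r_coset_def)
  then show "s (Suc n) \<subseteq> s n" by (simp add: g)
qed

text \<open>
  Right cosets of the normal subgroup \<open>R\<^sub>n\<close> are used throughout, whereas the approximations
  constructed below change by factors on the right.
\<close>
lemma in_Rst_coset:
  assumes "g \<in> G" "k \<in> Rst_level G n"
  shows "g \<odot> k \<in> Rst_level G n #>\<^bsub>Aut_tree\<^esub> g"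
proof -
  have "g \<odot> k \<odot> aut_inv g \<in> Rst_level G n"
    using normal.inv_op_closed2[OF normal_Rst_level, of g k n] assms subgroup_G by simp
  moreover have "g \<odot> k = (g \<odot> k \<odot> aut_inv g) \<odot> g"
    using assms subsetD[OF Rst_level_subset_G] by (simp add: Aut.m_assoc)
  ultimately show ?thesis unfolding r_coset_def by blast
qed

lemma St_level_prod_K:
  assumes "g \<in> St G (n + m)" "\<And>v. v \<in> level n \<Longrightarrow> sect g v \<in> 1 \<star> K"
  shows "g \<in> (n + 1) \<star> K"
proof -
  have "fixes_level (n + 1) g"
    unfolding fixes_level_add using assms by (auto simp: St_iff level_prod_K_iff fixes_level_add)
  moreover have "sect g v \<in> K" if v: "v \<in> level (n + 1)" for v
  proof -
    have "take n v \<in> level n" "drop n v \<in> level 1" using v by (auto simp: level_def)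
    then have "sect (sect g (take n v)) (drop n v) \<in> K"
      using assms(2) by (simp only: level_prod_K_iff)
    then show ?thesis by simp
  qed
  ultimately show ?thesis using assms(1) by (simp add: level_prod_K_iff St_iff)
qed

text \<open>
  Successive approximations of an element of the rigid kernel. The index is shifted by two
  so that \<open>g 0\<close> represents a class in \<open>S\<^sub>2/T\<^sub>2\<close>, the first factor of the rigid kernel.
\<close>
definition coherent :: "(nat \<Rightarrow> 'x portrait) \<Rightarrow> bool" where
  "coherent g \<longleftrightarrow> (\<forall>l. g l \<in> St G (l + 2) \<and> (\<exists>k\<in>(l + 1) \<star> K. g (Suc l) = g l \<odot> k))"

lemma coherent_le:
  assumes g: "coherent g" and "l \<le> m"
  shows "\<exists>k\<in>(l + 1) \<star> K. g m = g l \<odot> k"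
  using \<open>l \<le> m\<close>
proof (induction m rule: dec_induct)
  case base
  show ?case
    using g subgroup.one_closed[OF subgroup_level_prod_K]
    by (intro bexI[of _ "\<one>\<^bsub>Aut_tree\<^esub>"]) (auto simp: coherent_def St_iff)
next
  case (step m)
  then obtain k where k: "k \<in> (l + 1) \<star> K" "g m = g l \<odot> k" by blast
  from g obtain k' where k': "k' \<in> (m + 1) \<star> K" "g (Suc m) = g m \<odot> k'" by (auto simp: coherent_def)
  have "k' \<in> (l + 1) \<star> K" using k'(1) level_prod_K_antimono[of "l + 1" "m + 1"] step by auto
  then have "k \<odot> k' \<in> (l + 1) \<star> K" using k(1) subgroup.m_closed[OF subgroup_level_prod_K] by blast
  moreover have "g (Suc m) = g l \<odot> (k \<odot> k')"
  proof -
    have "g l \<in> carrier Aut_tree" using g by (auto simp: coherent_def St_iff)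
    then show ?thesis using k k' by (simp add: Aut.m_assoc level_prod_K_iff)
  qed
  ultimately show ?case by blast
qed

lemma coherent_thread:
  assumes g: "coherent g"
  shows "(\<lambda>n. Rst_level G n #>\<^bsub>Aut_tree\<^esub> g n) \<in> carrier RK"
proof -
  have gS: "g n \<in> St G n" for n
    using g St_antimono[of n "n + 2"] by (auto simp: coherent_def)
  moreover have "Rst_level G n #>\<^bsub>Aut_tree\<^esub> g (Suc n) = Rst_level G n #>\<^bsub>Aut_tree\<^esub> g n" for n
  proof -
    from g obtain k where k: "k \<in> (n + 1) \<star> K" "g (Suc n) = g n \<odot> k" by (auto simp: coherent_def)
    have "k \<in> Rst_level G n"
      using k(1) level_prod_K_subset_Rst_level Rst_level_antimono[of n "n + 1"] by auto
    then have "g (Suc n) \<in> Rst_level G n #>\<^bsub>Aut_tree\<^esub> g n"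
      using in_Rst_coset gS k(2) by (simp add: St_iff)
    then show ?thesis
      using Aut.repr_independence[OF _ _ subgroup_Rst_level] gS by (simp add: St_iff)
  qed
  ultimately show ?thesis unfolding carrier_rigid_kernel by blast
qed

end

section \<open>Lifting elements of stabilisers\<close>

locale stabilizer_lifting_group = regular_branch_group G for G :: "'x::finite portrait set" +
  assumes lifting: "St G 1 \<subseteq> St G 2 <#>\<^bsub>Aut_tree\<^esub> K"
begin

text \<open>
  The lifting hypothesis is applied to the section at each vertex of level \<open>n\<close>. The factors in
  \<open>K\<close> obtained there assemble to one element of \<open>n \<star> K \<subseteq> G\<close>, by which \<open>g\<close> is divided; the
  factors in \<open>S\<^sub>2\<close> are the sections of the quotient.
\<close>
lemma St_lift:
  assumes g: "g \<in> St G (n + 1)"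
  obtains a k where "a \<in> St G (n + 2)" "k \<in> n \<star> K" "g = a \<odot> k"
proof -
  have gG: "g \<in> G" "fixes_level n g" using g fixes_level_mono[of "n + 1" g n] by (simp_all add: St_iff)
  have "\<forall>v\<in>level n. \<exists>k. k \<in> K \<and> (\<exists>s\<in>St G 2. sect g v = s \<odot> k)"
  proof
    fix v :: "'x list" assume "v \<in> level n"
    then have "sect g v \<in> St G 2 <#>\<^bsub>Aut_tree\<^esub> K" using St_sect[OF g] lifting by blast
    then show "\<exists>k. k \<in> K \<and> (\<exists>s\<in>St G 2. sect g v = s \<odot> k)" by (auto simp: set_mult_def)
  qed
  from bchoice[OF this] obtain \<kappa>
    where \<kappa>: "\<And>v. v \<in> level n \<Longrightarrow> \<kappa> v \<in> K \<and> (\<exists>s\<in>St G 2. sect g v = s \<odot> \<kappa> v)" by blast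
  have \<kappa>c: "\<kappa> v \<in> carrier Aut_tree" if "v \<in> level n" for v using \<kappa>[OF that] K_subset_G by auto
  then obtain k where k: "k \<in> carrier Aut_tree" "fixes_level n k" "\<And>v. v \<in> level n \<Longrightarrow> sect k v = \<kappa> v"
    using with_sections_realise[of n \<kappa>] by blast
  have kK: "k \<in> n \<star> K" using k \<kappa> by (simp add: level_prod_K_iff)
  then have kG: "k \<in> G" using level_prod_K_subset_G by blast
  define a where "a = g \<odot> aut_inv k"
  have ga: "g = a \<odot> k" using gG kG by (simp add: a_def Aut.m_assoc)
  have "sect a v \<in> St G 2" if v: "v \<in> level n" for v
  proof -
    from \<kappa>[OF v] obtain s where s: "s \<in> St G 2" "sect g v = s \<odot> \<kappa> v" by blast
    have "sect a v = s \<odot> \<kappa> v \<odot> aut_inv (\<kappa> v)"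
      using k v s(2) sect_mult_fixes[OF fixes_level_inv[OF k(1,2)] v, of g]
      by (simp add: a_def sect_inv_fixes)
    also have "\<dots> = s" using s(1) \<kappa>c[OF v] by (simp add: Aut.m_assoc St_iff)
    finally show ?thesis using s(1) by simp
  qed
  moreover have "a \<in> G" "fixes_level n a"
    using gG kG k by (simp_all add: a_def fixes_level_mult fixes_level_inv)
  ultimately have "a \<in> St G (n + 2)" unfolding St_iff fixes_level_add by simp
  with kK ga that show thesis by blast
qed

text \<open>
  Each step lifts \<open>g l\<close> by \<open>St_lift\<close> and then corrects the section \<open>a\<close> of the lift at every
  vertex \<open>v\<close> of level \<open>l + 1\<close> by a prescribed factor \<open>\<kappa> v a\<close>. The correction may depend on
  \<open>a\<close>, which is only known once the lift has been chosen; this freedom gives surjectivity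
  onto all factors of the product indexed by the non-root vertices.
\<close>
lemma coherent_exists:
  assumes g0: "g0 \<in> St G 2"
    and \<kappa>: "\<And>v a. v \<noteq> [] \<Longrightarrow> a \<in> St G 2 \<Longrightarrow> \<kappa> v a \<in> St G 2 \<inter> K"
  obtains g where "coherent g" "g 0 = g0"
    "\<And>v. v \<noteq> [] \<Longrightarrow> \<exists>a\<in>St G 2. sect (g (length v)) v = a \<odot> \<kappa> v a"
proof -
  define P where "P l x \<longleftrightarrow> x \<in> St G (l + 2) \<and> (l = 0 \<longrightarrow> x = g0)" for l :: nat and x
  define Q where "Q l x y \<longleftrightarrow> (\<exists>k\<in>(l + 1) \<star> K. y = x \<odot> k) \<and>
    (\<forall>v\<in>level (l + 1). \<exists>a\<in>St G 2. sect y v = a \<odot> \<kappa> v a)" for l x y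
  have "\<exists>x. P 0 x" using g0 by (auto simp: P_def numeral_2_eq_2)
  moreover have "\<exists>y. P (Suc l) y \<and> Q l x y" if "P l x" for l x
  proof -
    have "x \<in> St G ((l + 1) + 1)" using that by (simp add: P_def)
    then obtain a k where a: "a \<in> St G (l + 1 + 2)" and k: "k \<in> (l + 1) \<star> K" and x: "x = a \<odot> k"
      by (rule St_lift)
    have a2: "sect a v \<in> St G 2" if "v \<in> level (l + 1)" for v using St_sect[OF a that] .
    have \<kappa>': "\<kappa> v (sect a v) \<in> St G 2 \<inter> K" if "v \<in> level (l + 1)" for v
      by (rule \<kappa>[OF _ a2[OF that]]) (use that in \<open>auto simp: level_def\<close>)
    then have "\<kappa> v (sect a v) \<in> carrier Aut_tree" if "v \<in> level (l + 1)" for v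
      using that by (simp add: St_iff)
    then obtain d where d: "d \<in> carrier Aut_tree" "fixes_level (l + 1) d"
      "\<And>v. v \<in> level (l + 1) \<Longrightarrow> sect d v = \<kappa> v (sect a v)"
      using with_sections_realise[of "l + 1" "\<lambda>v. \<kappa> v (sect a v)"] by blast
    have dK: "d \<in> (l + 1) \<star> K" using d \<kappa>' by (simp add: level_prod_K_iff)
    then have dG: "d \<in> G" using level_prod_K_subset_G by blast
    have "fixes_level (l + 1 + 2) d" using d \<kappa>' by (subst fixes_level_add) (simp add: St_iff)
    then have "a \<odot> d \<in> St G (l + 1 + 2)" using a dG by (simp add: St_iff fixes_level_mult)
    then have "P (Suc l) (a \<odot> d)" by (simp add: P_def)
    moreover have "Q l x (a \<odot> d)"
    proof -
      have "aut_inv k \<odot> d \<in> (l + 1) \<star> K"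
        using k dK subgroup.m_closed[OF subgroup_level_prod_K] subgroup.m_inv_closed[OF subgroup_level_prod_K]
        by blast
      moreover have "a \<odot> d = x \<odot> (aut_inv k \<odot> d)"
      proof -
        have "k \<odot> (aut_inv k \<odot> d) = d" using k d(1) by (simp add: level_prod_K_iff flip: Aut.m_assoc)
        then show ?thesis using a k d(1) by (simp add: x Aut.m_assoc level_prod_K_iff St_iff)
      qed
      moreover have "\<forall>v\<in>level (l + 1). \<exists>b\<in>St G 2. sect (a \<odot> d) v = b \<odot> \<kappa> v b"
        using a2 d sect_mult_fixes[OF d(2)] by auto
      ultimately show ?thesis unfolding Q_def by blast
    qed
    ultimately show ?thesis by blast
  qed
  ultimately obtain g where g: "\<And>l. P l (g l)" "\<And>l. Q l (g l) (g (Suc l))"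
    using dependent_nat_choice[of P Q] by blast
  show thesis
  proof
    show "coherent g" using g by (auto simp: coherent_def P_def Q_def)
    show "g 0 = g0" using g(1)[of 0] by (simp add: P_def)
    fix v :: "'x list" assume v: "v \<noteq> []"
    then obtain l where "length v = Suc l" by (cases v) auto
    then show "\<exists>a\<in>St G 2. sect (g (length v)) v = a \<odot> \<kappa> v a"
      using g(2)[of l] by (auto simp: Q_def level_def)
  qed
qed

lemma Triv_2: "Triv G 2 = St G 2 \<inter> 1 \<star> K"
  by (simp add: Triv_def)

theorem rigid_kernel_trivial_iff: "trivial_group RK \<longleftrightarrow> St G 2 = Triv G 2"
proof
  assume triv: "trivial_group RK"
  have "g0 \<in> 1 \<star> K" if g0: "g0 \<in> St G 2" for g0
  proof -
    have one: "\<one>\<^bsub>Aut_tree\<^esub> \<in> St G 2 \<inter> K"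
      using subgroup.one_closed[OF subgroup_St] subgroup.one_closed[OF subgroup_K] by blast
    obtain g where g: "coherent g" "g 0 = g0"
      by (rule coherent_exists[of g0 "\<lambda>_ _. \<one>\<^bsub>Aut_tree\<^esub>"]) (use g0 one in auto)
    have "(\<lambda>n. Rst_level G n #>\<^bsub>Aut_tree\<^esub> g n) = Rst_level G"
      using coherent_thread[OF g(1)] triv by (simp add: trivial_group_def one_rigid_kernel)
    then have "Rst_level G n #>\<^bsub>Aut_tree\<^esub> g n = Rst_level G n" for n by metis
    then have "g n \<in> Rst_level G n" for n
      using Aut.coset_join1[OF _ _ subgroup_Rst_level] g(1) by (simp add: coherent_def St_iff)
    \<comment> \<open>At this depth \<open>R\<^sub>n \<subseteq> 1 \<star> K\<close>, and \<open>g n\<close> differs from \<open>g 0\<close> by an element of \<open>1 \<star> K\<close>.\<close>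
    then have gK: "g (1 + stable_depth) \<in> 1 \<star> K"
      using Rst_level_subset_level_prod_K[of 1 "1 + stable_depth"] by auto
    obtain k where k: "k \<in> 1 \<star> K" "g (1 + stable_depth) = g 0 \<odot> k"
      using coherent_le[OF g(1), of 0 "1 + stable_depth"] by auto
    have "g0 = g (1 + stable_depth) \<odot> aut_inv k"
      using g0 k g(2) by (simp add: Aut.m_assoc level_prod_K_iff St_iff)
    then show ?thesis
      using gK k(1) subgroup.m_closed[OF subgroup_level_prod_K] subgroup.m_inv_closed[OF subgroup_level_prod_K]
      by metis
  qed
  then show "St G 2 = Triv G 2" by (auto simp: Triv_2)
next
  assume eq: "St G 2 = Triv G 2"
  have St: "St G (n + 2) \<subseteq> Rst_level G n" for n
  proof
    fix g assume g: "g \<in> St G (n + 2)"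
    have "sect g v \<in> 1 \<star> K" if "v \<in> level n" for v
      using St_sect[OF g that] eq Triv_2 by blast
    then have "g \<in> (n + 1) \<star> K" by (rule St_level_prod_K[OF g])
    then show "g \<in> Rst_level G n"
      using level_prod_K_subset_Rst_level Rst_level_antimono[of n "n + 1"] by auto
  qed
  have "s = Rst_level G" if s: "s \<in> carrier RK" for s
  proof
    fix n
    obtain g where g: "g \<in> s (n + 2)" using rigid_kernel_component_nonempty[OF s] by blast
    then have gR: "g \<in> Rst_level G n" using rigid_kernel_component(1)[OF s g] St by blast
    have "s n = Rst_level G n #>\<^bsub>Aut_tree\<^esub> g"
      using rigid_kernel_component(2)[OF s] g rigid_kernel_antimono[OF s, of n "n + 2"] by auto
    then show "s n = Rst_level G n"
      using Aut.coset_join2[OF _ subgroup_Rst_level gR] gR subgroup.subset[OF subgroup_Rst_level] by auto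
  qed
  then show "trivial_group RK"
    using group.trivial_group_subset[OF group_rigid_kernel] by (auto simp: one_rigid_kernel)
qed

end

section \<open>Classes of groups in which exact sequences split\<close>

lemma group_classD: "group_class \<C> \<Longrightarrow> \<C> A \<Longrightarrow> group A"
  unfolding group_class_def by blast

text \<open>
  The groups may live over different types; \<open>A\<close> is isomorphic to a subgroup of the copy of \<open>B\<close>
  in the class.
\<close>
lemma in_class_inj_hom:
  assumes gc: "group_class \<C>" and cs: "closed_subgroups \<C>"
    and A: "group A" and B: "group B" and h: "h \<in> hom A B" "inj_on h (carrier A)"
    and cB: "in_class \<C> B"
  shows "in_class \<C> A"
proof -
  obtain B0 where B0: "\<C> B0" "B0 \<cong> B" using cB by (auto simp: in_class_def)
  have g0: "group B0" using gc B0(1) by (rule group_classD)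
  obtain \<psi> where \<psi>: "\<psi> \<in> iso B B0" using group.iso_sym[OF g0 B0(2)] by (auto simp: is_iso_def)
  define k where "k = \<psi> \<circ> h"
  have k: "k \<in> hom A B0" using h(1) \<psi> by (auto simp: k_def iso_def intro: hom_compose)
  have ik: "inj_on k (carrier A)"
    unfolding k_def using h \<psi>
    by (auto simp: iso_def bij_betw_def hom_def intro!: comp_inj_on elim!: inj_on_subset)
  interpret k: group_hom A B0 k
    using A g0 k by (simp add: group_hom_def group_hom_axioms_def)
  have sub: "subgroup (k ` carrier A) B0" by (rule k.img_is_subgroup)
  then have "\<C> (B0\<lparr>carrier := k ` carrier A\<rparr>)"
    using cs B0 unfolding closed_subgroups_def by blast
  moreover have "k \<in> iso A (B0\<lparr>carrier := k ` carrier A\<rparr>)"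
    using k ik by (auto simp: iso_def bij_betw_def hom_def)
  ultimately show ?thesis
    using group.iso_sym[OF A] unfolding in_class_def is_iso_def by blast
qed

lemma in_class_DirProd:
  assumes gc: "group_class \<C>" and cp: "closed_products \<C>"
    and "in_class \<C> A" "in_class \<C> B"
  shows "in_class \<C> (A \<times>\<times> B)"
proof -
  obtain A0 B0 where "\<C> A0" "A0 \<cong> A" "\<C> B0" "B0 \<cong> B"
    using assms by (auto simp: in_class_def)
  moreover have "group A0" using gc calculation(1) by (rule group_classD)
  ultimately show ?thesis
    using group.DirProd_iso_trans[of A0 A B0 B] cp iso_trans
    unfolding closed_products_def in_class_def by metis
qed

lemma in_class_power:
  fixes Q :: "'a monoid" and I :: "'i set"
  assumes gc: "group_class \<C>" and cs: "closed_subgroups \<C>" and cp: "closed_products \<C>"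
    and Q: "group Q" "in_class \<C> Q" and "finite I"
  shows "in_class \<C> (product_group I (\<lambda>_. Q))"
  using \<open>finite I\<close>
proof (induction I)
  case empty
  have "(\<lambda>_. \<one>\<^bsub>Q\<^esub>) \<in> hom (product_group {} (\<lambda>_. Q)) Q"
    using Q(1) by (auto simp: hom_def group.is_monoid monoid.one_closed monoid.l_one)
  then show ?case
    by (rule in_class_inj_hom[OF gc cs product_group[OF Q(1)] Q(1) _ _ Q(2)]) (auto simp: inj_on_def)
next
  case (insert i I)
  define h :: "('i \<Rightarrow> 'a) \<Rightarrow> _" where "h = (\<lambda>f. (f i, restrict f I))"
  have "h \<in> hom (product_group (insert i I) (\<lambda>_. Q)) (Q \<times>\<times> product_group I (\<lambda>_. Q))"
    by (auto simp: hom_def h_def DirProd_def PiE_iff)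
  moreover have "inj_on h (carrier (product_group (insert i I) (\<lambda>_. Q)))"
  proof (rule inj_onI)
    fix f g assume f: "f \<in> carrier (product_group (insert i I) (\<lambda>_. Q))"
      and g: "g \<in> carrier (product_group (insert i I) (\<lambda>_. Q))" and e: "h f = h g"
    have "f j = g j" if "j \<in> insert i I" for j
      using e that unfolding h_def by (metis Pair_inject insertE restrict_apply')
    with f g show "f = g" by (auto simp: intro: PiE_ext)
  qed
  ultimately show ?case
    using in_class_inj_hom[OF gc cs] in_class_DirProd[OF gc cp Q(2) insert.IH] Q(1)
    by (metis DirProd_group product_group)
qed

text \<open>
  The first component of the splitting of \<open>N \<rightarrow> A \<rightarrow> A/N\<close>, transported from a copy of \<open>A\<close> in the
  class. Such a retraction is what the structure theorem asks of the class.
\<close>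
lemma in_class_retraction:
  assumes gc: "group_class \<C>" and cs: "closed_subgroups \<C>" and cq: "closed_quotients \<C>"
    and ss: "sequences_split \<C>" and A: "group A" "in_class \<C> A" and N: "N \<lhd> A"
  obtains \<rho> where "\<rho> \<in> hom A (A\<lparr>carrier := N\<rparr>)" "\<And>x. x \<in> N \<Longrightarrow> \<rho> x = x"
proof -
  interpret N: normal N A by (rule N)
  obtain A0 \<phi> where A0: "\<C> A0" and \<phi>: "\<phi> \<in> iso A0 A" using A(2) by (auto simp: in_class_def is_iso_def)
  have g0: "group A0" using gc A0 by (rule group_classD)
  interpret A0: group A0 by (rule g0)
  interpret \<phi>: group_hom A0 A \<phi> using g0 A(1) \<phi> by (simp add: group_hom_def group_hom_axioms_def iso_def)
  have b\<phi>: "bij_betw \<phi> (carrier A0) (carrier A)" using \<phi> by (simp add: iso_def)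
  define \<phi>' where "\<phi>' = inv_into (carrier A0) \<phi>"
  have \<phi>': "\<phi>' \<in> hom A A0" using A0.iso_set_sym[OF \<phi>] by (simp add: \<phi>'_def iso_def)
  define N0 where "N0 = {x \<in> carrier A0. \<phi> x \<in> N}"
  have sN0: "subgroup N0 A0"
    by (rule A0.subgroupI) (auto simp: N0_def intro!: exI[of _ "\<one>\<^bsub>A0\<^esub>"])
  have \<phi>N: "\<phi> \<in> hom (A0\<lparr>carrier := N0\<rparr>) (A\<lparr>carrier := N\<rparr>)"
  proof (rule homI)
    fix x assume "x \<in> carrier (A0\<lparr>carrier := N0\<rparr>)"
    then show "\<phi> x \<in> carrier (A\<lparr>carrier := N\<rparr>)" by (simp add: N0_def)
  next
    fix x y assume "x \<in> carrier (A0\<lparr>carrier := N0\<rparr>)" "y \<in> carrier (A0\<lparr>carrier := N0\<rparr>)"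
    then have "x \<in> carrier A0" "y \<in> carrier A0" by (simp_all add: N0_def)
    then show "\<phi> (x \<otimes>\<^bsub>A0\<lparr>carrier := N0\<rparr>\<^esub> y) = \<phi> x \<otimes>\<^bsub>A\<lparr>carrier := N\<rparr>\<^esub> \<phi> y" by simp
  qed
  have N0: "N0 \<lhd> A0"
    by (rule A0.normal_invI[OF sN0]) (auto simp: N0_def N.inv_op_closed2)
  interpret N0: normal N0 A0 by (rule N0)
  obtain Q where Q: "\<C> Q" "Q \<cong> A0 Mod N0"
    using cq A0 N0 unfolding closed_quotients_def in_class_def by blast
  have gQ: "group Q" using gc Q(1) by (rule group_classD)
  obtain \<psi> where \<psi>: "\<psi> \<in> iso (A0 Mod N0) Q"
    using group.iso_sym[OF gQ Q(2)] by (auto simp: is_iso_def)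
  define g where "g x = \<psi> (N0 #>\<^bsub>A0\<^esub> x)" for x
  have g: "g \<in> hom A0 Q"
    using hom_compose[OF N0.r_coset_hom_Mod, of \<psi> Q] \<psi> by (simp add: g_def[abs_def] comp_def iso_def)
  have epi: "g \<in> epi A0 Q"
  proof -
    have "g ` carrier A0 = \<psi> ` carrier (A0 Mod N0)"
      by (auto simp: g_def carrier_FactGroup)
    then show ?thesis using g \<psi> by (auto simp: epi_def iso_def bij_betw_def)
  qed
  interpret \<psi>: group_hom "A0 Mod N0" Q \<psi>
    using N0.factorgroup_is_group gQ \<psi> by (simp add: group_hom_def group_hom_axioms_def iso_def)
  have inj\<psi>: "inj_on \<psi> (carrier (A0 Mod N0))" using \<psi> by (simp add: iso_def bij_betw_def)
  have ker: "kernel A0 Q g = N0"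
  proof -
    have "g x = \<one>\<^bsub>Q\<^esub> \<longleftrightarrow> x \<in> N0" if x: "x \<in> carrier A0" for x
    proof -
      have c: "N0 #>\<^bsub>A0\<^esub> x \<in> carrier (A0 Mod N0)" using x by (auto simp: carrier_FactGroup)
      have "g x = \<one>\<^bsub>Q\<^esub> \<longleftrightarrow> N0 #>\<^bsub>A0\<^esub> x = N0"
        using \<psi>.inj_on_one_iff inj\<psi> c \<psi>.hom_one by (auto simp: g_def)
      also have "\<dots> \<longleftrightarrow> x \<in> N0" using x sN0 A0.coset_join1 A0.coset_join2 by blast
      finally show ?thesis .
    qed
    then show ?thesis using N0.subset by (auto simp: kernel_def)
  qed
  define N' where "N' = A0\<lparr>carrier := N0\<rparr>"
  have "\<C> N'" using cs A0 sN0 unfolding closed_subgroups_def N'_def by blast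
  have gN': "group N'" unfolding N'_def by (rule A0.subgroup_imp_group[OF sN0])
  have i: "(\<lambda>x. x) \<in> mon N' A0" using N0.subset by (auto simp: mon_def N'_def hom_def)
  have "short_exact_sequence Q A0 N' g (\<lambda>x. x)"
    unfolding short_exact_sequence_iff
  proof (intro conjI epi i)
    have "exact_seq ([A0, N'], [\<lambda>x. x])"
      using i g0 gN' by (intro exact_seq.unity) (simp add: mon_def group_hom_def group_hom_axioms_def)
    moreover have "kernel A0 Q g = (\<lambda>x. x) ` carrier N'" by (simp add: ker N'_def)
    ultimately show "exact_seq ([Q, A0, N'], [g, \<lambda>x. x])" by (rule exact_seq.extension[OF _ gQ g])
  qed
  then have "\<exists>\<theta>\<in>iso A0 (N' \<times>\<times> Q). (\<forall>x\<in>carrier N'. \<theta> x = (x, \<one>\<^bsub>Q\<^esub>)) \<and> (\<forall>a\<in>carrier A0. snd (\<theta> a) = g a)"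
    using ss \<open>\<C> N'\<close> A0 Q(1) unfolding sequences_split_def by blast
  then obtain \<theta> where \<theta>: "\<theta> \<in> iso A0 (N' \<times>\<times> Q)" and \<theta>': "\<forall>x\<in>carrier N'. \<theta> x = (x, \<one>\<^bsub>Q\<^esub>)"
    by blast
  have \<theta>N: "\<theta> x = (x, \<one>\<^bsub>Q\<^esub>)" if "x \<in> N0" for x using \<theta>' that by (simp add: N'_def)
  define \<rho> where "\<rho> a = \<phi> (fst (\<theta> (\<phi>' a)))" for a
  have \<phi>N': "\<phi> \<in> hom N' (A\<lparr>carrier := N\<rparr>)" using \<phi>N by (simp only: N'_def)
  have fst: "fst \<in> hom (N' \<times>\<times> Q) N'" by (rule homI) (auto simp: DirProd_def)
  have "\<theta> \<circ> \<phi>' \<in> hom A (N' \<times>\<times> Q)" using \<phi>' iso_imp_homomorphism[OF \<theta>] by (rule hom_compose)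
  then have "fst \<circ> (\<theta> \<circ> \<phi>') \<in> hom A N'" using fst by (rule hom_compose)
  then have "\<phi> \<circ> (fst \<circ> (\<theta> \<circ> \<phi>')) \<in> hom A (A\<lparr>carrier := N\<rparr>)" using \<phi>N' by (rule hom_compose)
  then have "\<rho> \<in> hom A (A\<lparr>carrier := N\<rparr>)" by (simp add: \<rho>_def[abs_def] comp_def)
  moreover have "\<rho> x = x" if "x \<in> N" for x
  proof -
    have x: "x \<in> \<phi> ` carrier A0" using b\<phi> that N.subset by (auto simp: bij_betw_def)
    then have "\<phi> (\<phi>' x) = x" "\<phi>' x \<in> carrier A0" by (auto simp: \<phi>'_def f_inv_into_f inv_into_into)
    then have "\<phi>' x \<in> N0" using that unfolding N0_def by simp
    then show ?thesis using \<theta>N \<open>\<phi> (\<phi>' x) = x\<close> by (simp add: \<rho>_def)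
  qed
  ultimately show ?thesis by (rule that)
qed

text \<open>
  For a subgroup that is not normal, some product of two right cosets is not a right coset.
  Here the product of \<open>K x\<close> and \<open>K x\<inverse>\<close> must be the coset \<open>K\<close>, as it contains the identity, and it
  also contains \<open>x h x\<inverse>\<close>.
\<close>
lemma normal_if_quotient_isomorphic_to_group:
  assumes G: "group G" and K: "subgroup K G" and B: "group B" and iso: "B \<cong> G Mod K"
  shows "K \<lhd> G"
proof -
  interpret G: group G by (rule G)
  interpret K: subgroup K G by (rule K)
  obtain \<phi> where \<phi>: "\<phi> \<in> hom B (G Mod K)" "\<phi> ` carrier B = carrier (G Mod K)"
    using iso by (auto simp: is_iso_def iso_def bij_betw_def)
  show ?thesis
  proof (rule G.normal_invI[OF K])
    fix x h assume x: "x \<in> carrier G" and h: "h \<in> K"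
    have "K #>\<^bsub>G\<^esub> x \<in> carrier (G Mod K)" "K #>\<^bsub>G\<^esub> inv\<^bsub>G\<^esub> x \<in> carrier (G Mod K)"
      using x by (auto simp: carrier_FactGroup)
    then obtain a b where ab: "a \<in> carrier B" "b \<in> carrier B" "\<phi> a = K #>\<^bsub>G\<^esub> x" "\<phi> b = K #>\<^bsub>G\<^esub> inv\<^bsub>G\<^esub> x"
      using \<phi>(2) by (metis imageE)
    have "\<phi> (a \<otimes>\<^bsub>B\<^esub> b) = (K #>\<^bsub>G\<^esub> x) <#>\<^bsub>G\<^esub> (K #>\<^bsub>G\<^esub> inv\<^bsub>G\<^esub> x)"
      using hom_mult[OF \<phi>(1) ab(1,2)] ab by simp
    moreover have "\<phi> (a \<otimes>\<^bsub>B\<^esub> b) \<in> carrier (G Mod K)"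
      using \<phi>(1) ab B by (meson group.is_monoid hom_in_carrier monoid.m_closed)
    ultimately obtain z where z: "z \<in> carrier G"
      "(K #>\<^bsub>G\<^esub> x) <#>\<^bsub>G\<^esub> (K #>\<^bsub>G\<^esub> inv\<^bsub>G\<^esub> x) = K #>\<^bsub>G\<^esub> z"
      by (auto simp: carrier_FactGroup)
    have m: "k \<otimes>\<^bsub>G\<^esub> x \<otimes>\<^bsub>G\<^esub> (l \<otimes>\<^bsub>G\<^esub> inv\<^bsub>G\<^esub> x) \<in> K #>\<^bsub>G\<^esub> z" if "k \<in> K" "l \<in> K" for k l
      unfolding z(2)[symmetric] using that by (auto simp: set_mult_def r_coset_def)
    have "\<one>\<^bsub>G\<^esub> \<in> K #>\<^bsub>G\<^esub> z" using m[OF K.one_closed K.one_closed] x by simp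
    then have "K #>\<^bsub>G\<^esub> z = K"
      using G.repr_independence[OF _ z(1) K] by (metis G.coset_mult_one K.subset)
    moreover have "x \<otimes>\<^bsub>G\<^esub> h \<otimes>\<^bsub>G\<^esub> inv\<^bsub>G\<^esub> x \<in> K #>\<^bsub>G\<^esub> z"
      using m[OF K.one_closed h] x h by (simp add: G.m_assoc)
    ultimately show "x \<otimes>\<^bsub>G\<^esub> h \<otimes>\<^bsub>G\<^esub> inv\<^bsub>G\<^esub> x \<in> K" by simp
  qed
qed

section \<open>Coordinates on the rigid kernel\<close>

locale normal_branching_group = stabilizer_lifting_group G for G :: "'x::finite portrait set" +
  assumes normal_K: "K \<lhd> as_group G"
begin

abbreviation "S2 \<equiv> St G 2"
abbreviation "T2 \<equiv> Triv G 2"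
abbreviation cls :: "'x portrait \<Rightarrow> 'x portrait set" where "cls a \<equiv> T2 #>\<^bsub>Aut_tree\<^esub> a"
abbreviation "SQ \<equiv> as_group S2 Mod T2"
abbreviation "KQ \<equiv> as_group (S2 \<inter> K) Mod T2"

lemma K_conj: "g \<in> G \<Longrightarrow> k \<in> K \<Longrightarrow> g \<odot> k \<odot> aut_inv g \<in> K"
  using normal.inv_op_closed2[OF normal_K, of g k] subgroup_G by simp

lemma S2_carrier: "a \<in> S2 \<Longrightarrow> a \<in> carrier Aut_tree"
  by (simp add: St_iff)

lemma subgroup_T2: "subgroup T2 Aut_tree"
  unfolding Triv_2 by (rule Aut.subgroups_Inter_pair[OF subgroup_St subgroup_level_prod_K])

lemma subgroup_S2_K: "subgroup (S2 \<inter> K) Aut_tree"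
  by (rule Aut.subgroups_Inter_pair[OF subgroup_St subgroup_K])

lemma T2_subset: "T2 \<subseteq> S2 \<inter> K"
  unfolding Triv_2 using level_prod_K_subset_K by blast

lemma normal_T2: "T2 \<lhd> as_group S2"
proof (rule group.normal_invI)
  show "group (as_group S2)" by (rule Aut.subgroup_imp_group[OF subgroup_St])
  show "subgroup T2 (as_group S2)"
    using T2_subset by (intro Aut.subgroup_incl[OF subgroup_T2 subgroup_St]) blast
  fix g h assume "g \<in> carrier (as_group S2)" and h: "h \<in> T2"
  then have g: "g \<in> S2" by simp
  then have gG: "g \<in> G" by (simp add: St_iff)
  have h1: "h \<in> S2" "h \<in> 1 \<star> K" using h by (simp_all add: Triv_2)
  then have hc: "h \<in> carrier Aut_tree" "fixes_level 1 h" by (simp_all add: level_prod_K_iff)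
  have "sect (g \<odot> h \<odot> aut_inv g) v \<in> K" if v: "v \<in> level 1" for v
    using sect_conj[of g 1 h v] gG hc v h1(2) K_conj[of "sect g (act (aut_inv g) v)" "sect h (act (aut_inv g) v)"]
    by (simp add: level_prod_K_iff)
  then have "g \<odot> h \<odot> aut_inv g \<in> 1 \<star> K"
    using fixes_level_conj[OF G_carrier[OF gG] hc(2)] gG hc by (simp add: level_prod_K_iff)
  moreover have "g \<odot> h \<odot> aut_inv g \<in> S2"
    using g h1 subgroup.m_closed[OF subgroup_St] subgroup.m_inv_closed[OF subgroup_St] by blast
  ultimately have "g \<odot> h \<odot> aut_inv g \<in> T2" unfolding Triv_2 by blast
  then show "g \<otimes>\<^bsub>as_group S2\<^esub> h \<otimes>\<^bsub>as_group S2\<^esub> inv\<^bsub>as_group S2\<^esub> g \<in> T2"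
    using g subgroup_St by simp
qed

lemma group_SQ: "group SQ"
  by (rule normal.factorgroup_is_group[OF normal_T2])

lemma carrier_SQ: "carrier SQ = cls ` S2"
  by (simp add: carrier_FactGroup)

lemma carrier_KQ: "carrier KQ = cls ` (S2 \<inter> K)"
  by (simp add: carrier_FactGroup)

lemma KQ_eq: "KQ = SQ\<lparr>carrier := carrier KQ\<rparr>"
  by (simp add: FactGroup_def)

lemma cls_mult: "a \<in> S2 \<Longrightarrow> b \<in> S2 \<Longrightarrow> cls a <#>\<^bsub>Aut_tree\<^esub> cls b = cls (a \<odot> b)"
  using normal.rcos_sum[OF normal_T2, of a b] by simp

lemma cls_hom: "cls \<in> hom (as_group S2) SQ"
  using normal.r_coset_hom_Mod[OF normal_T2] by simp

lemma group_hom_cls: "group_hom (as_group S2) SQ cls"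
  using cls_hom group_SQ Aut.subgroup_imp_group[OF subgroup_St]
  by (simp add: group_hom_def group_hom_axioms_def)

lemma cls_eq_T2_iff: "a \<in> S2 \<Longrightarrow> cls a = T2 \<longleftrightarrow> a \<in> T2"
  using Aut.coset_join1[OF _ _ subgroup_T2] Aut.coset_join2[OF _ subgroup_T2] S2_carrier by blast

lemma cls_mult_T2: "a \<in> S2 \<Longrightarrow> t \<in> T2 \<Longrightarrow> cls (t \<odot> a) = cls a"
  using Aut.repr_independence[OF _ _ subgroup_T2, of "t \<odot> a" a] S2_carrier
  by (auto simp: r_coset_def)

lemma cls_mult_T2_right: "a \<in> S2 \<Longrightarrow> t \<in> T2 \<Longrightarrow> cls (a \<odot> t) = cls a"
proof -
  assume a: "a \<in> S2" and t: "t \<in> T2"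
  then have tS: "t \<in> S2" using T2_subset by blast
  have "cls (a \<odot> t) = cls a <#>\<^bsub>Aut_tree\<^esub> cls t" using cls_mult[OF a tS] by simp
  also have "cls t = cls \<one>\<^bsub>Aut_tree\<^esub>"
    using cls_eq_T2_iff[OF tS] t subgroup.subset[OF subgroup_T2] by simp
  also have "cls a <#>\<^bsub>Aut_tree\<^esub> cls \<one>\<^bsub>Aut_tree\<^esub> = cls a"
    using cls_mult[OF a subgroup.one_closed[OF subgroup_St]] S2_carrier[OF a] by simp
  finally show ?thesis .
qed

text \<open>
  The exact sequence to be split is \<open>(S\<^sub>2 \<inter> K)/T\<^sub>2 \<rightarrow> S\<^sub>2/T\<^sub>2 \<rightarrow> S\<^sub>2/(S\<^sub>2 \<inter> K)\<close>.
\<close>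
lemma normal_KQ: "carrier KQ \<lhd> SQ"
proof (rule group.normal_invI[OF group_SQ])
  interpret cls: group_hom "as_group S2" SQ cls by (rule group_hom_cls)
  have "subgroup (S2 \<inter> K) (as_group S2)"
    by (rule Aut.subgroup_incl[OF subgroup_S2_K subgroup_St]) blast
  then show "subgroup (carrier KQ) SQ"
    unfolding carrier_KQ by (rule cls.subgroup_img_is_subgroup)
  fix C D assume "C \<in> carrier SQ" "D \<in> carrier KQ"
  then obtain a k where a: "a \<in> S2" "C = cls a" and k: "k \<in> S2 \<inter> K" "D = cls k"
    by (auto simp: carrier_SQ carrier_KQ)
  have inv: "inv\<^bsub>SQ\<^esub> cls a = cls (aut_inv a)"
    using cls.hom_inv[of a] a subgroup_St by simp
  have aS: "aut_inv a \<in> S2" "a \<odot> k \<in> S2"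
    using a k subgroup.m_inv_closed[OF subgroup_St] subgroup.m_closed[OF subgroup_St] by blast+
  have "C \<otimes>\<^bsub>SQ\<^esub> D \<otimes>\<^bsub>SQ\<^esub> inv\<^bsub>SQ\<^esub> C = cls (a \<odot> k \<odot> aut_inv a)"
    using a k aS by (simp add: inv cls_mult)
  moreover have "a \<odot> k \<odot> aut_inv a \<in> S2 \<inter> K"
    using K_conj[of a k] a k aS subgroup.m_closed[OF subgroup_St, of "a \<odot> k" 2 "aut_inv a"]
    by (simp add: St_iff)
  ultimately show "C \<otimes>\<^bsub>SQ\<^esub> D \<otimes>\<^bsub>SQ\<^esub> inv\<^bsub>SQ\<^esub> C \<in> carrier KQ"
    unfolding carrier_KQ by simp
qed

lemma group_KQ: "group KQ"
  using group.subgroup_imp_group[OF group_SQ normal_imp_subgroup[OF normal_KQ]] by (simp flip: KQ_eq)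

lemma K_coset_eq_iff: "a \<in> carrier Aut_tree \<Longrightarrow> K #>\<^bsub>Aut_tree\<^esub> a = K \<longleftrightarrow> a \<in> K"
  using Aut.coset_join1[OF _ _ subgroup_K] Aut.coset_join2[OF _ subgroup_K] by blast

text \<open>
  An element of \<open>S\<^sub>2\<close> lies in \<open>T\<^sub>2\<close> exactly when its sections at the first level lie in \<open>K\<close>.
  The embedding puts \<open>S\<^sub>2/T\<^sub>2\<close> into the class and also shows that it is finite.
\<close>
lemma SQ_embeds:
  obtains h where "h \<in> hom SQ (product_group UNIV (\<lambda>_ :: 'x. as_group G Mod K))" "inj_on h (carrier SQ)"
proof -
  let ?Q = "as_group G Mod K"
  let ?P = "product_group UNIV (\<lambda>_ :: 'x. ?Q)"
  have gQ: "group ?Q" by (rule normal.factorgroup_is_group[OF normal_K])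
  define h where "h g = (\<lambda>x. K #>\<^bsub>Aut_tree\<^esub> sect g [x])" for g :: "'x portrait"
  have "h \<in> hom (as_group S2) ?P"
  proof (rule homI)
    fix a assume "a \<in> carrier (as_group S2)"
    then show "h a \<in> carrier ?P" by (auto simp: h_def carrier_FactGroup St_iff)
  next
    fix a b assume ab: "a \<in> carrier (as_group S2)" "b \<in> carrier (as_group S2)"
    have "sect (a \<odot> b) [x] = sect a [x] \<odot> sect b [x]" for x
      using ab fixes_level_mono[of 2 b 1] by (intro sect_mult_fixes[of 1]) (auto simp: St_iff level_def)
    then show "h (a \<otimes>\<^bsub>as_group S2\<^esub> b) = h a \<otimes>\<^bsub>?P\<^esub> h b"
      using ab normal.rcos_sum[OF normal_K] by (simp add: h_def St_iff restrict_def)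
  qed
  then interpret h: group_hom "as_group S2" ?P h
    using Aut.subgroup_imp_group[OF subgroup_St] gQ
    by (simp add: group_hom_def group_hom_axioms_def)
  have "kernel (as_group S2) ?P h = T2"
  proof -
    have "h a = \<one>\<^bsub>?P\<^esub> \<longleftrightarrow> a \<in> 1 \<star> K" if a: "a \<in> S2" for a
    proof -
      have "h a = \<one>\<^bsub>?P\<^esub> \<longleftrightarrow> (\<forall>x. K #>\<^bsub>Aut_tree\<^esub> sect a [x] = K)" by (auto simp: h_def fun_eq_iff)
      also have "\<dots> \<longleftrightarrow> (\<forall>x. sect a [x] \<in> K)"
        using K_coset_eq_iff a by (simp add: St_iff)
      also have "\<dots> \<longleftrightarrow> a \<in> 1 \<star> K"
        using a fixes_level_mono[of 2 a 1]
        by (auto simp: level_prod_K_iff St_iff level_def length_Suc_conv)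
      finally show ?thesis .
    qed
    then show ?thesis by (auto simp: kernel_def Triv_2)
  qed
  with h.FactGroup_hom h.FactGroup_inj_on that show thesis by simp
qed

lemma finite_SQ: "finite (carrier SQ)"
proof -
  obtain h where h: "h \<in> hom SQ (product_group UNIV (\<lambda>_ :: 'x. as_group G Mod K))" "inj_on h (carrier SQ)"
    by (rule SQ_embeds)
  have "finite (carrier (product_group UNIV (\<lambda>_ :: 'x. as_group G Mod K)))"
    using finite_index_K by (auto intro: finite_PiE)
  then show ?thesis using h by (meson finite_imageD finite_subset hom_carrier)
qed

text \<open>
  The depth leaves room for all that is needed of a representative: it fixes two more levels
  below \<open>v\<close>, and it is determined up to sections in \<open>T\<^sub>2\<close> because \<open>R\<^sub>n \<subseteq> (l + 1) \<star> K\<close> for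
  \<open>n \<ge> l + 1 + N\<close>, where \<open>l\<close> is the length of \<open>v\<close>.
\<close>
definition coord :: "'x list \<Rightarrow> (nat \<Rightarrow> 'x portrait set) \<Rightarrow> 'x portrait set" where
  "coord v s = cls (sect (SOME g. g \<in> s (length v + 2 + stable_depth)) v)"

lemma coord_eq:
  assumes s: "s \<in> carrier RK" and g: "g \<in> s n" and n: "length v + 2 + stable_depth \<le> n"
  shows "coord v s = cls (sect g v)"
proof -
  let ?m = "length v + 2 + stable_depth"
  define g' where "g' = (SOME g. g \<in> s ?m)"
  have g': "g' \<in> s ?m"
    unfolding g'_def using rigid_kernel_component_nonempty[OF s] by (simp add: some_in_eq)
  have "g \<in> s ?m" using rigid_kernel_antimono[OF s n] g by blast
  then obtain r where r: "r \<in> Rst_level G ?m" "g = r \<odot> g'"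
    using rigid_kernel_component(2)[OF s g'] by (auto simp: r_coset_def)
  have v: "v \<in> level (length v)" by (simp add: level_def)
  have gS: "g' \<in> St G (length v + (2 + stable_depth))"
    using rigid_kernel_component(1)[OF s g'] by (simp add: add.assoc)
  then have sg: "sect g' v \<in> S2"
    using St_sect[OF _ v] St_antimono[of 2 "2 + stable_depth"] by auto
  have "sect r v \<in> S2"
    using St_sect[OF _ v, of r "2 + stable_depth"] St_antimono[of 2 "2 + stable_depth"] r(1) Rst_level_subset_St
    by (auto simp: add.assoc)
  moreover have "sect r v \<in> 1 \<star> K"
  proof -
    have "r \<in> (length v + 1) \<star> K" using r(1) Rst_level_subset_level_prod_K[of "length v + 1" ?m] by auto
    then show ?thesis using level_prod_K_add v by blast
  qed
  ultimately have "sect r v \<in> T2" unfolding Triv_2 by blast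
  moreover have "sect g v = sect r v \<odot> sect g' v"
    unfolding r(2)
  proof (rule sect_mult_fixes[OF _ v])
    show "fixes_level (length v) g'" 
      using gS fixes_level_mono[of "length v + (2 + stable_depth)" g' "length v"] by (simp add: St_iff)
  qed
  ultimately show ?thesis using cls_mult_T2 sg by (simp add: coord_def g'_def)
qed

lemma sect_in_S2:
  assumes "s \<in> carrier RK" "g \<in> s (length v + 2 + stable_depth)"
  shows "sect g v \<in> S2"
proof -
  have "g \<in> St G (length v + 2)"
    using rigid_kernel_component(1)[OF assms] St_antimono[of "length v + 2" "length v + 2 + stable_depth"] by auto
  then show ?thesis by (rule St_sect) (simp add: level_def)
qed

lemma coord_closed:
  assumes s: "s \<in> carrier RK" shows "coord v s \<in> carrier SQ"
proof -
  obtain g where g: "g \<in> s (length v + 2 + stable_depth)"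
    using rigid_kernel_component_nonempty[OF s] by blast
  have "coord v s = cls (sect g v)" by (rule coord_eq[OF s g]) simp
  then show ?thesis using sect_in_S2[OF s g] unfolding carrier_SQ by blast
qed

lemma coord_mult:
  assumes s: "s \<in> carrier RK" and t: "t \<in> carrier RK"
  shows "coord v (s \<otimes>\<^bsub>RK\<^esub> t) = coord v s \<otimes>\<^bsub>SQ\<^esub> coord v t"
proof -
  let ?m = "length v + 2 + stable_depth"
  obtain g h where gh: "g \<in> s ?m" "h \<in> t ?m" using rigid_kernel_component_nonempty s t by blast
  have st: "s \<otimes>\<^bsub>RK\<^esub> t \<in> carrier RK"
    using s t group.is_monoid[OF group_rigid_kernel] by (simp add: monoid.m_closed)
  have "g \<odot> h \<in> (s \<otimes>\<^bsub>RK\<^esub> t) ?m"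
    using gh unfolding mult_rigid_kernel set_mult_def by blast
  then have "coord v (s \<otimes>\<^bsub>RK\<^esub> t) = cls (sect (g \<odot> h) v)" using coord_eq[OF st] by blast
  also have "sect (g \<odot> h) v = sect g v \<odot> sect h v"
  proof (rule sect_mult_fixes[of "length v"])
    show "fixes_level (length v) h"
      using rigid_kernel_component(1)[OF t gh(2)] fixes_level_mono[of ?m h "length v"] by (simp add: St_iff)
  qed (simp add: level_def)
  also have "cls \<dots> = cls (sect g v) \<otimes>\<^bsub>SQ\<^esub> cls (sect h v)"
    using cls_mult sect_in_S2 s t gh by simp
  finally show ?thesis using coord_eq[OF s gh(1)] coord_eq[OF t gh(2)] by simp
qed

text \<open>
  The coordinates at level \<open>l\<close> are already visible in the \<open>l\<close>-th approximation, since later ones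
  differ from it by elements of \<open>(l + 1) \<star> K\<close>.
\<close>
lemma coord_thread:
  assumes g: "coherent g"
  shows "coord v (\<lambda>n. Rst_level G n #>\<^bsub>Aut_tree\<^esub> g n) = cls (sect (g (length v)) v)"
proof -
  let ?m = "length v + 2 + stable_depth" and ?s = "\<lambda>n. Rst_level G n #>\<^bsub>Aut_tree\<^esub> g n"
  have gS: "g l \<in> St G (l + 2)" for l using g by (simp add: coherent_def)
  have "g ?m \<in> ?s ?m" using gS Aut.rcos_self[OF _ subgroup_Rst_level] by (simp add: St_iff)
  then have c: "coord v ?s = cls (sect (g ?m) v)" by (rule coord_eq[OF coherent_thread[OF g]]) simp
  obtain k where k: "k \<in> (length v + 1) \<star> K" "g ?m = g (length v) \<odot> k"
    using coherent_le[OF g, of "length v" ?m] by auto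
  have v: "v \<in> level (length v)" by (simp add: level_def)
  have kf: "fixes_level (length v) k" 
    using k(1) fixes_level_mono[of "length v + 1" k "length v"] by (simp add: level_prod_K_iff)
  have s2: "sect (g (length v)) v \<in> S2" by (rule St_sect[OF gS v])
  have eq: "sect (g ?m) v = sect (g (length v)) v \<odot> sect k v"
    unfolding k(2) by (rule sect_mult_fixes[OF kf v])
  have s2': "sect (g ?m) v \<in> S2"
    using gS[of ?m] St_antimono[of "length v + 2" "?m + 2"] by (intro St_sect[OF _ v]) auto
  have k1: "sect k v \<in> 1 \<star> K" using level_prod_K_add[OF k(1) v] .
  have "sect k v = aut_inv (sect (g (length v)) v) \<odot> sect (g ?m) v"
    using eq S2_carrier[OF s2] k1 by (simp add: level_prod_K_iff flip: Aut.m_assoc)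
  then have "sect k v \<in> S2"
    using s2 s2' subgroup.m_inv_closed[OF subgroup_St] subgroup.m_closed[OF subgroup_St] by metis
  then have "sect k v \<in> T2" using k1 unfolding Triv_2 by blast
  then show ?thesis using c eq cls_mult_T2_right[OF s2] by simp
qed

text \<open>
  The map sends \<open>s\<close> to its coordinate at the root and to \<open>\<rho>\<close> of its coordinates elsewhere. A
  coordinate at \<open>v\<close> other than the root is not an arbitrary element of \<open>S\<^sub>2/T\<^sub>2\<close>: its class modulo
  \<open>(S\<^sub>2 \<inter> K)/T\<^sub>2\<close> is determined by the coordinates above \<open>v\<close>, and \<open>\<rho>\<close> extracts the free part.
\<close>
lemma rigid_kernel_iso_if_retraction:
  assumes \<rho>: "\<rho> \<in> hom SQ KQ" and \<rho>_id: "\<And>C. C \<in> carrier KQ \<Longrightarrow> \<rho> C = C"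
  shows "RK \<cong> SQ \<times>\<times> product_group (UNIV - {[]} :: 'x list set) (\<lambda>_. KQ)"
proof -
  let ?P = "product_group (UNIV - {[]} :: 'x list set) (\<lambda>_. KQ)"
  define \<Phi> where "\<Phi> s = (coord [] s, \<lambda>v\<in>UNIV - {[]}. \<rho> (coord v s))" for s
  have \<rho>_closed: "\<rho> C \<in> carrier KQ" if "C \<in> carrier SQ" for C using \<rho> that by (rule hom_in_carrier)
  have hom: "\<Phi> \<in> hom RK (SQ \<times>\<times> ?P)"
  proof (rule homI)
    fix s assume "s \<in> carrier RK"
    then show "\<Phi> s \<in> carrier (SQ \<times>\<times> ?P)"
      using coord_closed \<rho>_closed by (auto simp: \<Phi>_def DirProd_def)
  next
    fix s t assume st: "s \<in> carrier RK" "t \<in> carrier RK"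
    have "\<rho> (coord v (s \<otimes>\<^bsub>RK\<^esub> t)) = \<rho> (coord v s) \<otimes>\<^bsub>KQ\<^esub> \<rho> (coord v t)" for v
      using coord_mult[OF st] hom_mult[OF \<rho> coord_closed[OF st(1)] coord_closed[OF st(2)]] by simp
    then show "\<Phi> (s \<otimes>\<^bsub>RK\<^esub> t) = \<Phi> s \<otimes>\<^bsub>SQ \<times>\<times> ?P\<^esub> \<Phi> t"
      using coord_mult[OF st] by (simp add: \<Phi>_def DirProd_def fun_eq_iff)
  qed
  interpret \<Phi>: group_hom RK "SQ \<times>\<times> ?P" \<Phi>
    using hom group_rigid_kernel DirProd_group[OF group_SQ product_group[OF group_KQ]]
    by (simp add: group_hom_def group_hom_axioms_def)
  have "s = \<one>\<^bsub>RK\<^esub>" if s: "s \<in> carrier RK" and one: "\<Phi> s = \<one>\<^bsub>SQ \<times>\<times> ?P\<^esub>" for s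
  proof -
    have c0: "coord [] s = T2" using one by (simp add: \<Phi>_def DirProd_def)
    have c1: "\<rho> (coord v s) = T2" if "v \<noteq> []" for v
    proof -
      have "(\<lambda>v\<in>UNIV - {[]}. \<rho> (coord v s)) = (\<lambda>v\<in>UNIV - {[]}. T2)"
        using one by (simp add: \<Phi>_def DirProd_def)
      from fun_cong[OF this, of v] that show ?thesis by simp
    qed
    \<comment> \<open>The retraction detects triviality of a coordinate as soon as the coordinate at the parent
        vertex is trivial.\<close>
    have sec: "sect g v \<in> T2" if "g \<in> s (length v + 2 + stable_depth)" for g v
      using that
    proof (induction v rule: rev_induct)
      case Nil
      then show ?case
        using c0 coord_eq[OF s Nil] cls_eq_T2_iff[OF sect_in_S2[OF s Nil]] by simp
    next
      case (snoc x v)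
      have "g \<in> s (length v + 2 + stable_depth)"
        using snoc.prems rigid_kernel_antimono[OF s, of "length v + 2 + stable_depth" "length (v @ [x]) + 2 + stable_depth"]
        by auto
      then have "sect g v \<in> 1 \<star> K" using snoc.IH by (simp add: Triv_2)
      then have "sect (sect g v) [x] \<in> K" unfolding level_prod_K_iff by (simp add: level_def)
      then have SK: "sect g (v @ [x]) \<in> S2 \<inter> K" using sect_in_S2[OF s snoc.prems] by simp
      have c: "coord (v @ [x]) s = cls (sect g (v @ [x]))" by (rule coord_eq[OF s snoc.prems order_refl])
      then have "coord (v @ [x]) s \<in> carrier KQ" using SK unfolding carrier_KQ by blast
      then have "coord (v @ [x]) s = T2" using \<rho>_id c1[of "v @ [x]"] by simp
      then show ?case using c cls_eq_T2_iff SK by blast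
    qed
    have "s n = Rst_level G n" for n
    proof -
      obtain g where g: "g \<in> s (n + 2 + stable_depth)" using rigid_kernel_component_nonempty[OF s] by blast
      have gS: "g \<in> St G (n + (2 + stable_depth))"
        using rigid_kernel_component(1)[OF s g] by (simp add: add.assoc)
      have "sect g v \<in> 1 \<star> K" if "v \<in> level n" for v
        using sec[of g v] g that by (simp add: level_def Triv_2)
      then have "g \<in> (n + 1) \<star> K" by (rule St_level_prod_K[OF gS])
      then have gR: "g \<in> Rst_level G n"
        using level_prod_K_subset_Rst_level Rst_level_antimono[of n "n + 1"] by auto
      have "g \<in> s n" using g rigid_kernel_antimono[OF s, of n "n + 2 + stable_depth"] by auto
      moreover have "g \<in> carrier Aut_tree" using gS by (simp add: St_iff)
      ultimately show ?thesis
        using rigid_kernel_component(2)[OF s] Aut.coset_join2[OF _ subgroup_Rst_level gR] by simp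
    qed
    then show ?thesis by (auto simp: one_rigid_kernel)
  qed
  then have inj: "inj_on \<Phi> (carrier RK)" unfolding \<Phi>.inj_on_one_iff by blast
  have surj: "\<exists>s\<in>carrier RK. \<Phi> s = (q, p)" if q: "q \<in> carrier SQ" and p: "p \<in> carrier ?P" for q p
  proof -
    obtain g0 where g0: "g0 \<in> S2" "q = cls g0" using q unfolding carrier_SQ by blast
    have pv: "p v \<in> carrier KQ" if "v \<noteq> []" for v using p that by (auto simp: PiE_iff)
    interpret KQ: group KQ by (rule group_KQ)
    \<comment> \<open>The correction cancels the value of \<open>\<rho>\<close> on the uncorrected section and puts \<open>p v\<close> in its
        place.\<close>
    have "\<exists>k. k \<in> S2 \<inter> K \<and> cls k = inv\<^bsub>KQ\<^esub> \<rho> (cls a) \<otimes>\<^bsub>KQ\<^esub> p v" if "v \<noteq> []" "a \<in> S2" for v a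
    proof -
      have "inv\<^bsub>KQ\<^esub> \<rho> (cls a) \<otimes>\<^bsub>KQ\<^esub> p v \<in> carrier KQ"
        using \<rho>_closed[of "cls a"] pv that unfolding carrier_SQ by (intro KQ.m_closed KQ.inv_closed) auto
      then obtain k where "k \<in> S2 \<inter> K" "inv\<^bsub>KQ\<^esub> \<rho> (cls a) \<otimes>\<^bsub>KQ\<^esub> p v = cls k"
        unfolding carrier_KQ by (elim imageE)
      then show ?thesis by (intro exI[of _ k]) simp
    qed
    then obtain \<kappa> where \<kappa>: "\<And>v a. v \<noteq> [] \<Longrightarrow> a \<in> S2 \<Longrightarrow>
        \<kappa> v a \<in> S2 \<inter> K \<and> cls (\<kappa> v a) = inv\<^bsub>KQ\<^esub> \<rho> (cls a) \<otimes>\<^bsub>KQ\<^esub> p v" by metis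
    obtain g where g: "coherent g" "g 0 = g0"
      and gv: "\<And>v. v \<noteq> [] \<Longrightarrow> \<exists>a\<in>S2. sect (g (length v)) v = a \<odot> \<kappa> v a"
      by (rule coherent_exists[OF g0(1), of \<kappa>]) (use \<kappa> in blast)+
    let ?s = "\<lambda>n. Rst_level G n #>\<^bsub>Aut_tree\<^esub> g n"
    have \<rho>p: "\<rho> (coord v ?s) = p v" if v: "v \<noteq> []" for v
    proof -
      from gv[OF v] obtain a where a: "a \<in> S2" "sect (g (length v)) v = a \<odot> \<kappa> v a" by blast
      have k: "\<kappa> v a \<in> S2" "cls (\<kappa> v a) \<in> carrier KQ" "cls (\<kappa> v a) \<in> carrier SQ" "cls a \<in> carrier SQ"
        using \<kappa>[OF v a(1)] a(1) unfolding carrier_KQ carrier_SQ by auto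
      have "\<rho> (coord v ?s) = \<rho> (cls a \<otimes>\<^bsub>SQ\<^esub> cls (\<kappa> v a))"
        using coord_thread[OF g(1), of v] a k by (simp add: cls_mult)
      also have "\<dots> = \<rho> (cls a) \<otimes>\<^bsub>KQ\<^esub> \<rho> (cls (\<kappa> v a))"
        using \<rho> k(4,3) by (rule hom_mult)
      also have "\<dots> = \<rho> (cls a) \<otimes>\<^bsub>KQ\<^esub> (inv\<^bsub>KQ\<^esub> \<rho> (cls a) \<otimes>\<^bsub>KQ\<^esub> p v)"
        using \<rho>_id[OF k(2)] \<kappa>[OF v a(1)] by simp
      also have "\<dots> = \<rho> (cls a) \<otimes>\<^bsub>KQ\<^esub> inv\<^bsub>KQ\<^esub> \<rho> (cls a) \<otimes>\<^bsub>KQ\<^esub> p v"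
        using \<rho>_closed[OF k(4)] KQ.inv_closed[OF \<rho>_closed[OF k(4)]] pv[OF v] by (rule KQ.m_assoc[symmetric])
      also have "\<dots> = p v"
        unfolding KQ.r_inv[OF \<rho>_closed[OF k(4)]] using pv[OF v] by (rule KQ.l_one)
      finally show ?thesis .
    qed
    have "(\<lambda>v\<in>UNIV - {[]}. \<rho> (coord v ?s)) = (\<lambda>v\<in>UNIV - {[]}. p v)"
      by (rule restrict_ext) (rule \<rho>p, simp)
    also have "\<dots> = p" using p by (simp add: PiE_restrict)
    finally have "\<Phi> ?s = (q, p)"
      using coord_thread[OF g(1), of "[]"] g(2) g0(2) by (simp add: \<Phi>_def)
    then show ?thesis using coherent_thread[OF g(1)] by blast
  qed
  have "\<Phi> ` carrier RK = carrier (SQ \<times>\<times> ?P)"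
  proof
    show "\<Phi> ` carrier RK \<subseteq> carrier (SQ \<times>\<times> ?P)" using hom by (rule hom_carrier)
    show "carrier (SQ \<times>\<times> ?P) \<subseteq> \<Phi> ` carrier RK"
    proof
      fix y assume "y \<in> carrier (SQ \<times>\<times> ?P)"
      then have "fst y \<in> carrier SQ" "snd y \<in> carrier ?P" by (simp_all only: DirProd_def partial_object.simps mem_Times_iff)
      from surj[OF this] obtain s where "s \<in> carrier RK" "\<Phi> s = y" by (auto simp: prod_eq_iff)
      then show "y \<in> \<Phi> ` carrier RK" by blast
    qed
  qed
  then have "\<Phi> \<in> iso RK (SQ \<times>\<times> ?P)" using hom inj by (simp add: iso_def bij_betw_def)
  then show ?thesis by (rule is_isoI)
qed

theorem rigid_kernel_structure:
  assumes "group_class \<C>" "closed_subgroups \<C>" "closed_quotients \<C>" "closed_products \<C>"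
    "sequences_split \<C>" "in_class \<C> (as_group G Mod K)"
  shows "RK \<cong> SQ \<times>\<times> product_group (UNIV - {[]} :: 'x list set) (\<lambda>_. KQ)"
proof -
  have gQ: "group (as_group G Mod K)" by (rule normal.factorgroup_is_group[OF normal_K])
  obtain h where h: "h \<in> hom SQ (product_group UNIV (\<lambda>_ :: 'x. as_group G Mod K))" "inj_on h (carrier SQ)"
    by (rule SQ_embeds)
  have "in_class \<C> (product_group UNIV (\<lambda>_ :: 'x. as_group G Mod K))"
    by (rule in_class_power[OF assms(1,2,4) gQ assms(6)]) simp
  then have "in_class \<C> SQ"
    using in_class_inj_hom[OF assms(1,2) group_SQ product_group[OF gQ] h] by blast
  then obtain \<rho> where \<rho>: "\<rho> \<in> hom SQ (SQ\<lparr>carrier := carrier KQ\<rparr>)" "\<And>C. C \<in> carrier KQ \<Longrightarrow> \<rho> C = C"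
    using in_class_retraction[OF assms(1-3,5) group_SQ _ normal_KQ] by blast
  show ?thesis by (rule rigid_kernel_iso_if_retraction[OF \<rho>(1)[folded KQ_eq] \<rho>(2)])
qed

theorem infinite_rigid_kernel_iff:
  assumes iso: "RK \<cong> SQ \<times>\<times> product_group (UNIV - {[]} :: 'x list set) (\<lambda>_. KQ)"
  shows "infinite (carrier RK) \<longleftrightarrow> \<not> trivial_group KQ"
proof -
  let ?P = "product_group (UNIV - {[]} :: 'x list set) (\<lambda>_. KQ)"
  have "carrier (SQ \<times>\<times> ?P) = carrier SQ \<times> carrier ?P" by (simp add: DirProd_def)
  moreover have "carrier SQ \<noteq> {}" "carrier ?P \<noteq> {}"
    using group.is_monoid group_SQ product_group[OF group_KQ] monoid.one_closed by blast+
  ultimately have "finite (carrier RK) \<longleftrightarrow> finite (carrier ?P)"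
    using iso_finite[OF iso] finite_SQ by (auto simp: finite_cartesian_product_iff simp del: carrier_product_group)
  also have "\<dots> \<longleftrightarrow> trivial_group KQ"
  proof -
    have "infinite (UNIV - {[]} :: 'x list set)" using infinite_UNIV_listI by simp
    moreover have "finite (carrier KQ)"
      using finite_subset[OF _ finite_SQ] by (simp add: carrier_SQ carrier_KQ image_mono)
    ultimately show ?thesis
      using finite_product_group[of "UNIV - {[]} :: 'x list set" "\<lambda>_. KQ"] group_KQ
      by (cases "trivial_group KQ") auto
  qed
  finally show ?thesis by blast
qed

end

theorem theorem3:
  fixes G :: "'x::finite portrait set"
    and K :: "'x portrait set"
    and \<C> :: "'c monoid \<Rightarrow> bool"
  assumes "subgroup G Aut_tree"
    and "self_similar G"
    and "level_transitive G"
    and "regular_branch G"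
    and "K = max_branching G"
    and "St G 1 \<subseteq> St G 2 <#>\<^bsub>Aut_tree\<^esub> K"
  shows "(trivial_group (rigid_kernel G) \<longleftrightarrow> St G 2 = Triv G 2) \<and>
    (group_class \<C> \<and> closed_subgroups \<C> \<and> closed_quotients \<C> \<and> closed_products \<C> \<and>
       sequences_split \<C> \<and> in_class \<C> (as_group G Mod K) \<longrightarrow>
     rigid_kernel G \<cong>
       (as_group (St G 2) Mod Triv G 2) \<times>\<times>
       product_group (UNIV - {[]} :: 'x list set)
         (\<lambda>_. as_group (St G 2 \<inter> K) Mod Triv G 2) \<and>
     (infinite (carrier (rigid_kernel G)) \<longleftrightarrow>
        \<not> trivial_group (as_group (St G 2 \<inter> K) Mod Triv G 2)))"
proof -
  interpret stabilizer_lifting_group G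
    by (intro stabilizer_lifting_group.intro regular_branch_group.intro
        stabilizer_lifting_group_axioms.intro assms(1-4) assms(6)[unfolded assms(5)])
  have part2: "rigid_kernel G \<cong> (as_group (St G 2) Mod Triv G 2) \<times>\<times>
       product_group (UNIV - {[]} :: 'x list set) (\<lambda>_. as_group (St G 2 \<inter> K) Mod Triv G 2) \<and>
     (infinite (carrier (rigid_kernel G)) \<longleftrightarrow>
        \<not> trivial_group (as_group (St G 2 \<inter> K) Mod Triv G 2))"
    if \<C>: "group_class \<C>" "closed_subgroups \<C>" "closed_quotients \<C>" "closed_products \<C>"
      "sequences_split \<C>" "in_class \<C> (as_group G Mod K)"
  proof -
    from \<C>(6) obtain B where B: "\<C> B" "B \<cong> as_group G Mod K" by (auto simp: in_class_def)
    have "K \<lhd> as_group G"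
    proof (rule normal_if_quotient_isomorphic_to_group[OF _ _ _ B(2)])
      show "group (as_group G)" by (rule Aut.subgroup_imp_group[OF subgroup_G])
      show "subgroup K (as_group G)"
        unfolding assms(5) by (rule Aut.subgroup_incl[OF subgroup_K subgroup_G K_subset_G])
      show "group B" using \<C>(1) B(1) by (rule group_classD)
    qed
    then interpret normal_branching_group G
      by (intro normal_branching_group.intro stabilizer_lifting_group_axioms
          normal_branching_group_axioms.intro) (simp add: assms(5))
    show ?thesis
      using rigid_kernel_structure[OF \<C>(1-5)] \<C>(6) infinite_rigid_kernel_iff
      unfolding assms(5) by blast
  qed
  show ?thesis using rigid_kernel_trivial_iff part2 by blast
qed

end
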